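(* Consider the homogeneous post-local algorithm (see context) with deterministic schedules $(\vartheta_t)$, $(\Lambda_t)$ satisfying $L<\Lambda_t\le2L$ and $\Lambda_t\vartheta_t\le L/2$, and assume the PL condition $\|\nabla F(x)\|^2\ge2\mu(F(x)-F_\star)$ for every $x\in B(x_\star,R)$. Then, for every $t\ge0$, $$g_{t+1}\le(1-\rho_t^{\mathrm{hom}})g_t+\delta_t^{\mathrm{hom}},\qquad \rho_t^{\mathrm{hom}}:=\frac{\mu\vartheta_t}{2L}-\beta_t^{\mathrm{hom}}.$$ If, in addition, $\vartheta_t\equiv\vartheta$ and $\Lambda_t\equiv\Lambda$ (so that $\beta_t^{\mathrm{hom}}\equiv\beta^{\mathrm{hom}}$, $\delta_t^{\mathrm{hom}}\equiv\delta^{\mathrm{hom}}$) and $\rho^{\mathrm{hom}}:=\frac{\mu\vartheta}{2L}-\beta^{\mathrm{hom}}>0$, then $$g_t\le(1-\rho^{\mathrm{hom}})^tg_0+\frac{\delta^{\mathrm{hom}}}{\rho^{\mathrm{hom}}}.$$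
   Context: Problem: $F(x)=\frac1n\sum_{i=1}^nF_i(x)$, $F_i(x)=\frac1{m_i}\sum_{j=1}^{m_i}\phi_{ij}(x)$, each $\phi_{ij}:\mathbb R^d\to\mathbb R$ convex and $L$-smooth ($L$-Lipschitz gradient). There are $x_\star\in\arg\min F$ and $R>0$; $B(x_\star,R)=\{x:\|x-x_\star\|\le R\}$, $F_\star:=F(x_\star)$. Node $i$ has horizon $H_i\ge1$, minibatch size $b_i$, and $v_i^2:=\sup_{x\in B(x_\star,R)}\frac1{m_i}\sum_j\|\nabla\phi_{ij}(x)-\nabla F_i(x)\|^2$. Homogeneous post-local algorithm (all nodes active). In round $t$, with amplitude $\vartheta_t\in[\underline\theta,\bar\theta]$ ($0<\underline\theta\le\bar\theta$) and curvature $\Lambda_t>L$, each $i\in[n]$ sets $\eta_{i,t}=\vartheta_t/(LH_i)$, $y_{i,t}^{(0)}=x_t$ and, for $\ell=0,\dots,H_i-1$, draws a minibatch $\mathcal B_{i,t,\ell}$, computes a stochastic gradient $g_{i,t,\ell}$ and sets $y_{i,t}^{(\ell+1)}=y_{i,t}^{(\ell)}-\eta_{i,t}g_{i,t,\ell}$. Put $\Delta_{i,t}=y_{i,t}^{(H_i)}-x_t$, $g_{i,t}^{\mathrm{loc}}=-(\eta_{i,t}H_i)^{-1}\Delta_{i,t}$, $\bar g_t=\frac1n\sum_ig_{i,t}^{\mathrm{loc}}$, $$\Psi_t^{\mathrm{hom}}(w)=\Bigl\langle\bar g_t,\sum_iw_i\Delta_{i,t}\Bigr\rangle+\frac{\Lambda_t}2\Bigl\|\sum_iw_i\Delta_{i,t}\Bigr\|^2.$$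 The server picks $w_t^{\mathrm{hom}}\in\arg\min_{w\in\Delta_n}\Psi_t^{\mathrm{hom}}(w)$, $\Delta_n=\{w\in\mathbb R_+^n:\sum_iw_i=1\}$ (measurably), and sets $x_{t+1}=x_t+\sum_iw_{i,t}^{\mathrm{hom}}\Delta_{i,t}$. Standing assumptions: almost surely $x_t,y_{i,t}^{(\ell)}\in B(x_\star,R)$ for all $t,i,\ell$. $\mathcal F_t$ is generated by the initial state and all minibatches drawn strictly before round $t$; $\mathcal G_{i,t,\ell}$ by $\mathcal F_t$ and all minibatches of node $i$ drawn strictly before local step $\ell$ of round $t$. Conditionally on $\mathcal G_{i,t,\ell}$ the minibatches are independent across nodes and local steps. Homogeneous oracle condition: $\mathbb E[g_{i,t,\ell}\mid\mathcal G_{i,t,\ell}]=\nabla F(y_{i,t}^{(\ell)})$ and $\mathbb E[\|g_{i,t,\ell}-\nabla F(y_{i,t}^{(\ell)})\|^2\mid\mathcal G_{i,t,\ell}]\le v_i^2/b_i$ for every node $i$ and local step $\ell$. Notation: $g_t:=\mathbb E[F(x_t)-F_\star]$; $\bar V_1:=\frac1n\sum_i\frac{v_i^2}{H_ib_i}$; $V_u:=\frac1{n^2}\sum_i\frac{v_i^2}{H_ib_i}$; $\beta_t^{\mathrm{hom}}:=16\vartheta_t^3+16\frac{L\vartheta_t^2}{\Lambda_t-L}$; $\delta_t^{\mathrm{hom}}:=\bigl(4\frac{\vartheta_t^3}L+4\frac{\vartheta_t^2}{\Lambda_t-L}\bigr)\bar V_1+\bigl(\frac{\vartheta_t}L+\frac1{\Lambda_t-L}\bigr)V_u$.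 *)

theory Defs
  imports "HOL-Probability.Probability"
begin

definition grad :: "('a::real_inner \<Rightarrow> real) \<Rightarrow> 'a \<Rightarrow> 'a" where
  "grad f x = (THE D. GDERIV f x :> D)"

definition smooth :: "real \<Rightarrow> ('a::real_inner \<Rightarrow> real) \<Rightarrow> bool" where
  "smooth L f \<longleftrightarrow> (\<forall>x. \<exists>D. GDERIV f x :> D) \<and> L-lipschitz_on UNIV (grad f)"

definition node_obj :: "(nat \<Rightarrow> nat) \<Rightarrow> (nat \<Rightarrow> nat \<Rightarrow> 'a \<Rightarrow> real) \<Rightarrow> nat \<Rightarrow> 'a \<Rightarrow> real" where
  "node_obj m \<phi> i x = (1 / real (m i)) * (\<Sum>j<m i. \<phi> i j x)"

definition obj :: "nat \<Rightarrow> (nat \<Rightarrow> nat) \<Rightarrow> (nat \<Rightarrow> nat \<Rightarrow> 'a \<Rightarrow> real) \<Rightarrow> 'a \<Rightarrow> real" where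
  "obj n m \<phi> x = (1 / real n) * (\<Sum>i<n. node_obj m \<phi> i x)"

text \<open>This is \<open>v\<^sub>i\<^sup>2\<close>. For smooth \<open>\<phi> i j\<close> the supremum is that of a continuous function over a
  nonempty compact ball, so it is a genuine (finite) supremum.\<close>

definition grad_var ::
  "(nat \<Rightarrow> nat) \<Rightarrow> (nat \<Rightarrow> nat \<Rightarrow> 'a::euclidean_space \<Rightarrow> real) \<Rightarrow> 'a \<Rightarrow> real \<Rightarrow> nat \<Rightarrow> real" where
  "grad_var m \<phi> xs R i =
     (SUP x\<in>cball xs R. (1 / real (m i)) *
        (\<Sum>j<m i. (norm (grad (\<phi> i j) x - grad (node_obj m \<phi> i) x))\<^sup>2))"

text \<open>The library's conditional expectation is real-valued; for vectors it is taken
  coordinatewise.\<close>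

definition has_cond_exp ::
  "'w measure \<Rightarrow> 'w measure \<Rightarrow> ('w \<Rightarrow> 'a::euclidean_space) \<Rightarrow> ('w \<Rightarrow> 'a) \<Rightarrow> bool" where
  "has_cond_exp M G X Y \<longleftrightarrow> integrable M X \<and>
     (AE \<omega> in M. \<forall>e\<in>Basis. real_cond_exp M G (\<lambda>\<omega>. X \<omega> \<bullet> e) \<omega> = Y \<omega> \<bullet> e)"

definition cond_prob :: "'w measure \<Rightarrow> 'w measure \<Rightarrow> 'w set \<Rightarrow> 'w \<Rightarrow> real" where
  "cond_prob M G A = real_cond_exp M G (indicat_real A)"

definition cond_indep_vars ::
  "'w measure \<Rightarrow> 'w measure \<Rightarrow> ('k \<Rightarrow> 'b measure) \<Rightarrow> ('k \<Rightarrow> 'w \<Rightarrow> 'b) \<Rightarrow> 'k set \<Rightarrow> bool" where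
  "cond_indep_vars M G N X K \<longleftrightarrow>
     (\<forall>k\<in>K. X k \<in> measurable M (N k)) \<and>
     (\<forall>J\<subseteq>K. J \<noteq> {} \<longrightarrow> finite J \<longrightarrow>
       (\<forall>A. (\<forall>j\<in>J. A j \<in> sets (N j)) \<longrightarrow>
         (AE \<omega> in M. cond_prob M G (\<Inter>j\<in>J. X j -` A j \<inter> space M) \<omega>
                      = (\<Prod>j\<in>J. cond_prob M G (X j -` A j \<inter> space M) \<omega>))))"

text \<open>Minibatches are finite multisets of sample indices, which covers sampling with and without
  replacement; \<open>\<B> i t l\<close> is the minibatch of node \<open>i\<close> at local step \<open>l\<close> of round \<open>t\<close>.  A set of
  minibatches needs no measurability restriction, since they form a countable discrete space.\<close>

definition round_hist ::
  "'w measure \<Rightarrow> nat \<Rightarrow> (nat \<Rightarrow> nat) \<Rightarrow> ('w \<Rightarrow> 'a::topological_space) \<Rightarrow>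
   (nat \<Rightarrow> nat \<Rightarrow> nat \<Rightarrow> 'w \<Rightarrow> nat multiset) \<Rightarrow> nat \<Rightarrow> 'w measure" where
  "round_hist M n H x0 \<B> t = sigma (space M)
     ({x0 -` A \<inter> space M | A. A \<in> sets borel} \<union>
      {\<B> i s l -` A \<inter> space M | i s l A. i < n \<and> s < t \<and> l < H i})"

definition local_hist ::
  "'w measure \<Rightarrow> nat \<Rightarrow> (nat \<Rightarrow> nat) \<Rightarrow> ('w \<Rightarrow> 'a::topological_space) \<Rightarrow>
   (nat \<Rightarrow> nat \<Rightarrow> nat \<Rightarrow> 'w \<Rightarrow> nat multiset) \<Rightarrow> nat \<Rightarrow> nat \<Rightarrow> nat \<Rightarrow> 'w measure" where
  "local_hist M n H x0 \<B> i t l = sigma (space M)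
     (sets (round_hist M n H x0 \<B> t) \<union> {\<B> i t k -` A \<inter> space M | k A. k < l})"

definition simplex_weights :: "nat \<Rightarrow> (nat \<Rightarrow> real) set" where
  "simplex_weights n = {w. (\<forall>i<n. 0 \<le> w i) \<and> (\<Sum>i<n. w i) = 1}"

definition aggregate :: "nat \<Rightarrow> (nat \<Rightarrow> 'a::real_vector) \<Rightarrow> (nat \<Rightarrow> real) \<Rightarrow> 'a" where
  "aggregate n \<Delta> w = (\<Sum>i<n. w i *\<^sub>R \<Delta> i)"

definition local_step :: "real \<Rightarrow> real \<Rightarrow> nat \<Rightarrow> real" where
  "local_step L \<theta> h = \<theta> / (L * real h)"

definition local_grad :: "real \<Rightarrow> real \<Rightarrow> (nat \<Rightarrow> nat) \<Rightarrow> (nat \<Rightarrow> 'a::real_vector) \<Rightarrow> nat \<Rightarrow> 'a" where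
  "local_grad L \<theta> H \<Delta> i = - (inverse (local_step L \<theta> (H i) * real (H i)) *\<^sub>R \<Delta> i)"

definition mean_grad :: "nat \<Rightarrow> real \<Rightarrow> real \<Rightarrow> (nat \<Rightarrow> nat) \<Rightarrow> (nat \<Rightarrow> 'a::real_vector) \<Rightarrow> 'a" where
  "mean_grad n L \<theta> H \<Delta> = (1 / real n) *\<^sub>R (\<Sum>i<n. local_grad L \<theta> H \<Delta> i)"

definition \<Psi>_hom ::
  "nat \<Rightarrow> real \<Rightarrow> real \<Rightarrow> real \<Rightarrow> (nat \<Rightarrow> nat) \<Rightarrow> (nat \<Rightarrow> 'a::real_inner) \<Rightarrow> (nat \<Rightarrow> real) \<Rightarrow> real" where
  "\<Psi>_hom n L \<theta> \<Lambda> H \<Delta> w =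
     mean_grad n L \<theta> H \<Delta> \<bullet> aggregate n \<Delta> w + \<Lambda> / 2 * (norm (aggregate n \<Delta> w))\<^sup>2"

definition V_bar1 :: "nat \<Rightarrow> (nat \<Rightarrow> nat) \<Rightarrow> (nat \<Rightarrow> nat) \<Rightarrow> (nat \<Rightarrow> real) \<Rightarrow> real" where
  "V_bar1 n H b v2 = (1 / real n) * (\<Sum>i<n. v2 i / (real (H i) * real (b i)))"

definition V_u :: "nat \<Rightarrow> (nat \<Rightarrow> nat) \<Rightarrow> (nat \<Rightarrow> nat) \<Rightarrow> (nat \<Rightarrow> real) \<Rightarrow> real" where
  "V_u n H b v2 = (1 / (real n)\<^sup>2) * (\<Sum>i<n. v2 i / (real (H i) * real (b i)))"

definition \<beta>_hom :: "real \<Rightarrow> real \<Rightarrow> real \<Rightarrow> real" where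
  "\<beta>_hom L \<theta> \<Lambda> = 16 * \<theta> ^ 3 + 16 * (L * \<theta>\<^sup>2 / (\<Lambda> - L))"

definition \<delta>_hom :: "real \<Rightarrow> real \<Rightarrow> real \<Rightarrow> real \<Rightarrow> real \<Rightarrow> real" where
  "\<delta>_hom L V1 Vu \<theta> \<Lambda> =
     (4 * (\<theta> ^ 3 / L) + 4 * (\<theta>\<^sup>2 / (\<Lambda> - L))) * V1 + (\<theta> / L + 1 / (\<Lambda> - L)) * Vu"

definition \<rho>_hom :: "real \<Rightarrow> real \<Rightarrow> real \<Rightarrow> real \<Rightarrow> real" where
  "\<rho>_hom \<mu> L \<theta> \<Lambda> = \<mu> * \<theta> / (2 * L) - \<beta>_hom L \<theta> \<Lambda>"

end

theory Submission
  imports Defs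
begin

text \<open>
  Everything in one round except the size of the noise is a pathwise inequality.  Write \<open>G\<close> for the
  gradient of \<open>F\<close> at \<open>x t\<close>, \<open>gb\<close> for the mean of the local gradients and \<open>e = gb - G\<close>.  Uniform
  weights are admissible and move the server by \<open>- (\<theta> / L) gb\<close>, so the optimal weights make the model
  \<open>\<Psi>_hom\<close> at most \<open>- (\<theta> / (2 * L)) (norm gb)\<^sup>2\<close>.  The descent lemma, with Young's inequality against the
  surplus curvature \<open>\<Lambda> - L\<close>, turns this into a decrease of \<open>F\<close> by \<open>\<theta> / (4 * L) * (norm G)\<^sup>2\<close> up to a
  multiple of \<open>(norm e)\<^sup>2\<close> (\<open>server_decrease\<close>).  The error \<open>e\<close> is the average of the centred increments
  \<open>\<xi> i l = g i l - grad F (y i l)\<close> plus the bias caused by evaluating gradients along the local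
  trajectories instead of at \<open>x t\<close>.  Because \<open>\<theta> < 1 / 2\<close>, the distance travelled by a local trajectory
  is controlled by the partial sums of its increments and by \<open>norm G\<close>, without any expectation
  (\<open>local_drift_bound\<close>); \<open>round_decrease\<close> combines the two estimates.

  What remains is to bound second moments of sums of increments, and this only needs that distinct
  increments of one round are orthogonal in \<open>L\<^sup>2\<close>.  For two increments of the same node this is the
  martingale property.  For two nodes the oracle condition is relative to the node's own history, and
  orthogonality comes from conditional independence: both local histories are generated by the round
  history and the cylinder events of the node's minibatches, which are independent given the round
  history, so an increment of one node stays centred when conditioned on the history of the other
  (\<open>cond_indep_zero_mean\<close>).  The centred increments are almost surely bounded, since a local step between
  two points of the ball is a fixed multiple of the stochastic gradient; hence integrability is never an
  issue.

  Taking expectations and using the Polyak-Lojasiewicz inequality on one part of \<open>(norm G)\<^sup>2\<close> and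
  \<open>(norm G)\<^sup>2 \<le> 2 * L * (F - F\<^sub>*)\<close> on the other gives the one-round recursion.  For constant parameters
  it unrolls because \<open>\<rho>_hom \<le> 1\<close> as soon as \<open>F\<close> is not constant on the ball; on a ball where \<open>F\<close> is
  constant all gaps vanish.
\<close>

section \<open>Smooth functions\<close>

lemma grad_eqI:
  assumes "GDERIV f x :> D"
  shows "grad f x = D"
proof -
  have "D' = D" if "GDERIV f x :> D'" for D'
  proof -
    have "(\<lambda>h. h \<bullet> D') = (\<lambda>h. h \<bullet> D)"
      using has_derivative_unique assms that unfolding gderiv_def by blast
    then have "(D' - D) \<bullet> D' = (D' - D) \<bullet> D" by metis
    then have "(D' - D) \<bullet> (D' - D) = 0" by (simp add: inner_diff_right)
    then show ?thesis by simp
  qed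
  then show ?thesis unfolding grad_def using assms by blast
qed

lemma smooth_GDERIV:
  assumes "smooth L f"
  shows "GDERIV f x :> grad f x"
  using assms grad_eqI unfolding smooth_def by metis

lemma smooth_grad_diff:
  assumes "smooth L f"
  shows "norm (grad f x - grad f y) \<le> L * norm (x - y)"
  using assms unfolding smooth_def lipschitz_on_def dist_norm by blast

lemma smooth_continuous_grad:
  assumes "smooth L f"
  shows "continuous_on UNIV (grad f)"
  using assms unfolding smooth_def by (blast intro: lipschitz_on_continuous_on)

lemma smooth_continuous:
  assumes "smooth L f"
  shows "continuous_on UNIV f"
proof -
  have "f differentiable (at x)" for x
    using smooth_GDERIV[OF assms, of x] unfolding gderiv_def differentiable_def by blast
  then show ?thesis
    by (intro continuous_at_imp_continuous_on ballI differentiable_imp_continuous_within)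
qed

lemma average_le:
  fixes a :: "nat \<Rightarrow> real"
  assumes "k \<ge> 1" "\<And>j. j < k \<Longrightarrow> a j \<le> C"
  shows "(1 / real k) * (\<Sum>j<k. a j) \<le> C"
proof -
  have "(\<Sum>j<k. a j) \<le> real k * C"
    using sum_bounded_above[of "{..<k}" a C] assms(2) by simp
  then show ?thesis using assms(1) by (simp add: field_simps)
qed

lemma norm_average_le:
  fixes a :: "nat \<Rightarrow> 'a::real_normed_vector"
  assumes "k \<ge> 1" "\<And>j. j < k \<Longrightarrow> norm (a j) \<le> C"
  shows "norm ((1 / real k) *\<^sub>R (\<Sum>j<k. a j)) \<le> C"
proof -
  have "norm ((1 / real k) *\<^sub>R (\<Sum>j<k. a j)) \<le> (1 / real k) * (\<Sum>j<k. norm (a j))"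
    by (simp add: norm_sum divide_right_mono)
  also have "\<dots> \<le> C" using assms by (rule average_le)
  finally show ?thesis .
qed

lemma smooth_average:
  assumes "k \<ge> 1" and sm: "\<And>j. j < k \<Longrightarrow> smooth L (f j)"
  shows "smooth L (\<lambda>x. (1 / real k) * (\<Sum>j<k. f j x))"
proof -
  have der: "GDERIV (\<lambda>x. (1 / real k) * (\<Sum>j<k. f j x)) x :>
      (1 / real k) *\<^sub>R (\<Sum>j<k. grad (f j) x)" for x
  proof -
    have "((\<lambda>x. (1 / real k) * (\<Sum>j<k. f j x)) has_derivative
        (\<lambda>h. (1 / real k) * (\<Sum>j<k. h \<bullet> grad (f j) x))) (at x)"
      using smooth_GDERIV[OF sm] unfolding gderiv_def
      by (intro has_derivative_mult_right has_derivative_sum) auto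
    then show ?thesis unfolding gderiv_def by (simp add: inner_sum_right)
  qed
  have g: "grad (\<lambda>x. (1 / real k) * (\<Sum>j<k. f j x)) = (\<lambda>x. (1 / real k) *\<^sub>R (\<Sum>j<k. grad (f j) x))"
    using grad_eqI[OF der] by blast
  have L0: "0 \<le> L" using sm[of 0] assms(1) unfolding smooth_def lipschitz_on_def by simp
  have "norm ((1 / real k) *\<^sub>R (\<Sum>j<k. grad (f j) x) - (1 / real k) *\<^sub>R (\<Sum>j<k. grad (f j) y))
      \<le> L * norm (x - y)" for x y
    using norm_average_le[OF assms(1), of "\<lambda>j. grad (f j) x - grad (f j) y" "L * norm (x - y)"]
      smooth_grad_diff[OF sm] by (simp add: sum_subtractf scaleR_diff_right)
  then show ?thesis using der L0 unfolding smooth_def g lipschitz_on_def dist_norm by blast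
qed

lemma smooth_node_obj:
  assumes "m i \<ge> 1" "\<And>j. j < m i \<Longrightarrow> smooth L (\<phi> i j)"
  shows "smooth L (node_obj m \<phi> i)"
  using smooth_average[of "m i" L "\<phi> i"] assms unfolding node_obj_def by simp

lemma smooth_obj:
  assumes "n \<ge> 1" "\<And>i. i < n \<Longrightarrow> m i \<ge> 1" "\<And>i j. i < n \<Longrightarrow> j < m i \<Longrightarrow> smooth L (\<phi> i j)"
  shows "smooth L (obj n m \<phi>)"
  using smooth_average[of n L "node_obj m \<phi>"] assms smooth_node_obj unfolding obj_def by blast

text \<open>The supremum is over a bounded set of values, because the gradients are continuous and the ball
  is compact; only then is it at least the value at the centre.\<close>

lemma grad_var_nonneg:
  fixes \<phi> :: "nat \<Rightarrow> nat \<Rightarrow> 'a::euclidean_space \<Rightarrow> real"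
  assumes m: "m i \<ge> 1" and sm: "\<And>j. j < m i \<Longrightarrow> smooth L (\<phi> i j)" and "R \<ge> 0"
  shows "0 \<le> grad_var m \<phi> xs R i"
proof -
  define h where "h x = (1 / real (m i)) *
      (\<Sum>j<m i. (norm (grad (\<phi> i j) x - grad (node_obj m \<phi> i) x))\<^sup>2)" for x
  have "continuous_on UNIV h" unfolding h_def
    by (intro continuous_intros smooth_continuous_grad[OF sm]
        smooth_continuous_grad[OF smooth_node_obj[where m = m and \<phi> = \<phi> and i = i, OF m sm]]) auto
  then have "compact (h ` cball xs R)"
    by (intro compact_continuous_image compact_cball) (rule continuous_on_subset, auto)
  then have "bdd_above (h ` cball xs R)"
    by (intro bounded_imp_bdd_above compact_imp_bounded)
  then have "h xs \<le> (SUP x\<in>cball xs R. h x)"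
    using \<open>R \<ge> 0\<close> by (intro cSUP_upper) auto
  moreover have "0 \<le> h xs" unfolding h_def by (simp add: sum_nonneg)
  ultimately show ?thesis unfolding grad_var_def h_def by linarith
qed

text \<open>The descent lemma: the quadratic model with curvature \<open>L\<close> at \<open>x\<close> lies above \<open>f\<close>.\<close>

lemma smooth_upper_bound:
  assumes sm: "smooth L f"
  shows "f (x + s) \<le> f x + grad f x \<bullet> s + L / 2 * (norm s)\<^sup>2"
proof -
  \<comment> \<open>The error of the quadratic model along the segment is nonincreasing in \<open>t\<close>.\<close>
  define h where "h t = f (x + t *\<^sub>R s) - t * (grad f x \<bullet> s) - L / 2 * t\<^sup>2 * (norm s)\<^sup>2" for t
  have der: "(h has_real_derivative
      (s \<bullet> grad f (x + t *\<^sub>R s) - grad f x \<bullet> s - L * t * (norm s)\<^sup>2)) (at t)" for t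
  proof -
    have f': "(f has_derivative (\<lambda>h. h \<bullet> grad f (x + t *\<^sub>R s))) (at (x + t *\<^sub>R s))"
      using smooth_GDERIV[OF sm] unfolding gderiv_def .
    have "((\<lambda>t. x + t *\<^sub>R s) has_derivative (\<lambda>u. u *\<^sub>R s)) (at t)"
      by (auto intro!: derivative_eq_intros)
    from has_derivative_compose[OF this f']
    have "((\<lambda>t. f (x + t *\<^sub>R s)) has_derivative (\<lambda>u. (u *\<^sub>R s) \<bullet> grad f (x + t *\<^sub>R s))) (at t)" .
    then have "((\<lambda>t. f (x + t *\<^sub>R s)) has_real_derivative (s \<bullet> grad f (x + t *\<^sub>R s))) (at t)"
      unfolding has_field_derivative_def by (simp add: mult.commute[of _ "s \<bullet> _"])
    then show ?thesis unfolding h_def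
      by (auto intro!: derivative_eq_intros simp: power2_eq_square)
  qed
  have "h 1 \<le> h 0"
  proof (rule DERIV_nonpos_imp_nonincreasing[where f = h and a = 0 and b = 1])
    fix t :: real assume t: "0 \<le> t" "t \<le> 1"
    have "s \<bullet> grad f (x + t *\<^sub>R s) - grad f x \<bullet> s = s \<bullet> (grad f (x + t *\<^sub>R s) - grad f x)"
      by (simp add: inner_diff_right inner_commute)
    also have "\<dots> \<le> norm s * norm (grad f (x + t *\<^sub>R s) - grad f x)" by (rule norm_cauchy_schwarz)
    also have "\<dots> \<le> norm s * (L * norm (t *\<^sub>R s))"
      using smooth_grad_diff[OF sm, of "x + t *\<^sub>R s" x] by (intro mult_left_mono) auto
    also have "\<dots> = L * t * (norm s)\<^sup>2" using t by (simp add: power2_eq_square)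
    finally show "\<exists>y. (h has_real_derivative y) (at t) \<and> y \<le> 0"
      using der by (intro exI conjI) auto
  qed simp
  then show ?thesis unfolding h_def by simp
qed

text \<open>Compare the minimum with the value after a gradient step of length \<open>1 / L\<close>.\<close>

lemma smooth_grad_le_gap:
  assumes sm: "smooth L f" and "L > 0" and min: "\<And>z. f xs \<le> f z"
  shows "(norm (grad f x))\<^sup>2 \<le> 2 * L * (f x - f xs)"
proof -
  have "f xs \<le> f (x + (- (1 / L)) *\<^sub>R grad f x)" by (rule min)
  also have "\<dots> \<le> f x + grad f x \<bullet> ((- (1 / L)) *\<^sub>R grad f x)
      + L / 2 * (norm ((- (1 / L)) *\<^sub>R grad f x))\<^sup>2"
    by (rule smooth_upper_bound[OF sm])
  also have "\<dots> = f x - (norm (grad f x))\<^sup>2 / (2 * L)"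
    using \<open>L > 0\<close> by (simp add: power_divide dot_square_norm field_simps power2_eq_square)
  finally show ?thesis using \<open>L > 0\<close> by (simp add: field_simps)
qed

section \<open>One round, pathwise\<close>

lemma norm_add_sq_le:
  fixes a b :: "'a::real_inner"
  shows "(norm (a + b))\<^sup>2 \<le> 2 * (norm a)\<^sup>2 + 2 * (norm b)\<^sup>2"
proof -
  have "0 \<le> (norm (a - b))\<^sup>2" by simp
  then show ?thesis
    by (simp add: power2_norm_eq_inner inner_add inner_diff inner_commute algebra_simps)
qed

lemma norm_sum_sq_le:
  fixes a :: "nat \<Rightarrow> 'a::real_inner"
  shows "(norm (\<Sum>j<k. a j))\<^sup>2 \<le> real k * (\<Sum>j<k. (norm (a j))\<^sup>2)"
proof -
  have "(norm (\<Sum>j<k. a j))\<^sup>2 \<le> (\<Sum>j<k. norm (a j))\<^sup>2"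
    by (intro power_mono norm_sum) auto
  also have "\<dots> \<le> (\<Sum>j<k. (norm (a j))\<^sup>2) * real (card {..<k})"
    by (rule sum_squared_le_sum_of_squares)
  finally show ?thesis by (simp add: mult.commute)
qed

lemma norm_average_sq_le:
  fixes a :: "nat \<Rightarrow> 'a::real_inner"
  assumes "k \<ge> 1"
  shows "(norm ((1 / real k) *\<^sub>R (\<Sum>j<k. a j)))\<^sup>2 \<le> (1 / real k) * (\<Sum>j<k. (norm (a j))\<^sup>2)"
proof -
  have "(norm ((1 / real k) *\<^sub>R (\<Sum>j<k. a j)))\<^sup>2 = (1 / real k)\<^sup>2 * (norm (\<Sum>j<k. a j))\<^sup>2"
    by (simp add: power_divide)
  also have "\<dots> \<le> (1 / real k)\<^sup>2 * (real k * (\<Sum>j<k. (norm (a j))\<^sup>2))"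
    by (intro mult_left_mono norm_sum_sq_le) auto
  finally show ?thesis using assms by (simp add: power2_eq_square)
qed

lemma sum_of_nat_le: "(\<Sum>l<k. real l) \<le> (real k)\<^sup>2 / 2"
  by (induction k) (auto simp: power2_eq_square algebra_simps)

text \<open>Drift of a local trajectory of \<open>h\<close> steps.  Each \<open>y l - x\<close> is \<open>- \<eta>\<close> times the sum of the increments
  plus the sum of the true gradients; the latter differ from the gradient at \<open>x\<close> by at most \<open>L\<close> times
  the earlier drift, and the smallness of \<open>\<eta> * L * h\<close> allows this part to be absorbed on the left.\<close>

lemma local_drift_bound:
  fixes y g :: "nat \<Rightarrow> 'a::real_inner"
  assumes sm: "smooth L f" and \<eta>: "(\<eta> * L * real h)\<^sup>2 \<le> 1 / 4"
    and y0: "y 0 = x" and step: "\<And>l. l < h \<Longrightarrow> y (Suc l) = y l - \<eta> *\<^sub>R g l"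
  shows "L\<^sup>2 * (\<Sum>l<h. (norm (y l - x))\<^sup>2)
    \<le> 4 * (\<eta> * L)\<^sup>2 * (\<Sum>l<h. (norm (\<Sum>k<l. g k - grad f (y k)))\<^sup>2)
      + 4 * (\<eta> * L * real h)\<^sup>2 * (real h * (norm (grad f x))\<^sup>2)"
proof -
  define N where "N l = (norm (\<Sum>k<l. g k - grad f (y k)))\<^sup>2" for l
  define G where "G = (norm (grad f x))\<^sup>2"
  define a where "a l = (norm (y l - x))\<^sup>2" for l
  \<comment> \<open>\<open>q k\<close> bounds the squared gradient at \<open>y k\<close>.\<close>
  define q where "q k = 2 * G + 2 * L\<^sup>2 * a k" for k
  define Q where "Q = (\<Sum>k<h. q k)"
  have q0: "0 \<le> q k" for k unfolding q_def G_def a_def by simp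
  have qG: "(norm (grad f (y k)))\<^sup>2 \<le> q k" for k
  proof -
    have "(norm (grad f x + (grad f (y k) - grad f x)))\<^sup>2
        \<le> 2 * G + 2 * (norm (grad f (y k) - grad f x))\<^sup>2"
      unfolding G_def by (rule norm_add_sq_le)
    moreover have "(norm (grad f (y k) - grad f x))\<^sup>2 \<le> (L * norm (y k - x))\<^sup>2"
      using smooth_grad_diff[OF sm] by (intro power_mono) auto
    ultimately show ?thesis unfolding q_def a_def by (simp add: power_mult_distrib)
  qed
  have yl: "y l - x = - \<eta> *\<^sub>R (\<Sum>k<l. g k)" if "l \<le> h" for l
    using that
  proof (induction l)
    case (Suc l)
    then have "y (Suc l) - x = (y l - x) - \<eta> *\<^sub>R g l" using step[of l] by simp
    then show ?case using Suc by (simp add: algebra_simps)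
  qed (simp add: y0)
  have al: "a l \<le> 2 * \<eta>\<^sup>2 * N l + 2 * \<eta>\<^sup>2 * (real l * Q)" if "l < h" for l
  proof -
    have "a l = \<eta>\<^sup>2 * (norm ((\<Sum>k<l. g k - grad f (y k)) + (\<Sum>k<l. grad f (y k))))\<^sup>2"
      unfolding a_def using yl[of l] that by (simp add: power_mult_distrib sum_subtractf)
    also have "\<dots> \<le> \<eta>\<^sup>2 * (2 * N l + 2 * (norm (\<Sum>k<l. grad f (y k)))\<^sup>2)"
      unfolding N_def by (intro mult_left_mono norm_add_sq_le) auto
    also have "\<dots> \<le> \<eta>\<^sup>2 * (2 * N l + 2 * (real l * Q))"
    proof -
      have "(norm (\<Sum>k<l. grad f (y k)))\<^sup>2 \<le> real l * (\<Sum>k<l. (norm (grad f (y k)))\<^sup>2)"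
        by (rule norm_sum_sq_le)
      also have "\<dots> \<le> real l * (\<Sum>k<l. q k)" by (intro mult_left_mono sum_mono qG) auto
      also have "\<dots> \<le> real l * Q" unfolding Q_def
        using that q0 by (intro mult_left_mono sum_mono2) auto
      finally show ?thesis by (intro mult_left_mono) auto
    qed
    finally show ?thesis by (simp add: algebra_simps)
  qed
  have Q0: "0 \<le> Q" unfolding Q_def using q0 by (simp add: sum_nonneg)
  have Qe: "Q = 2 * real h * G + 2 * L\<^sup>2 * (\<Sum>l<h. a l)"
    unfolding Q_def q_def by (simp add: sum.distrib sum_distrib_left)
  \<comment> \<open>Summing \<open>l\<close> over \<open>l < h\<close> gains the factor \<open>1 / 2\<close> that makes the drift term absorbable.\<close>
  have "(\<Sum>l<h. a l) \<le> (\<Sum>l<h. 2 * \<eta>\<^sup>2 * N l + 2 * \<eta>\<^sup>2 * (real l * Q))"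
    by (intro sum_mono al) auto
  also have "\<dots> = 2 * \<eta>\<^sup>2 * (\<Sum>l<h. N l) + 2 * \<eta>\<^sup>2 * Q * (\<Sum>l<h. real l)"
    by (simp add: sum.distrib sum_distrib_left sum_distrib_right mult_ac)
  also have "\<dots> \<le> 2 * \<eta>\<^sup>2 * (\<Sum>l<h. N l) + 2 * \<eta>\<^sup>2 * Q * ((real h)\<^sup>2 / 2)"
    using Q0 sum_of_nat_le[of h] by (intro add_left_mono mult_left_mono) auto
  finally have "L\<^sup>2 * (\<Sum>l<h. a l)
      \<le> L\<^sup>2 * (2 * \<eta>\<^sup>2 * (\<Sum>l<h. N l) + 2 * \<eta>\<^sup>2 * Q * ((real h)\<^sup>2 / 2))"
    by (intro mult_left_mono) auto
  also have "\<dots> = 2 * (\<eta> * L)\<^sup>2 * (\<Sum>l<h. N l) + 2 * (\<eta> * L * real h)\<^sup>2 * (real h * G)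
      + 2 * (\<eta> * L * real h)\<^sup>2 * (L\<^sup>2 * (\<Sum>l<h. a l))"
    unfolding Qe by (simp add: algebra_simps power2_eq_square)
  also have "\<dots> \<le> 2 * (\<eta> * L)\<^sup>2 * (\<Sum>l<h. N l) + 2 * (\<eta> * L * real h)\<^sup>2 * (real h * G)
      + 1 / 2 * (L\<^sup>2 * (\<Sum>l<h. a l))"
  proof -
    have "0 \<le> L\<^sup>2 * (\<Sum>l<h. a l)" unfolding a_def by (simp add: sum_nonneg)
    then show ?thesis using \<eta> by (intro add_left_mono mult_right_mono) auto
  qed
  finally show ?thesis unfolding a_def N_def G_def by linarith
qed

text \<open>The server step.  The bound \<open>\<Lambda> * \<theta> \<le> L / 2\<close> makes the quadratic term of the model at the uniform
  weights at most a quarter of the linear one.\<close>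

lemma server_decrease:
  fixes \<Delta> :: "nat \<Rightarrow> 'a::real_inner" and F :: "'a \<Rightarrow> real"
  assumes sm: "smooth L F" and n: "n \<ge> 1" and H: "\<And>i. i < n \<Longrightarrow> H i \<ge> 1"
    and L: "0 < L" "L < \<Lambda>" and \<theta>: "0 < \<theta>" "\<Lambda> * \<theta> \<le> L / 2"
    and w: "is_arg_min (\<Psi>_hom n L \<theta> \<Lambda> H \<Delta>) (\<lambda>u. u \<in> simplex_weights n) w"
  shows "F (x + aggregate n \<Delta> w) \<le> F x - \<theta> / (4 * L) * (norm (grad F x))\<^sup>2
    + (\<theta> / (2 * L) + 1 / (2 * (\<Lambda> - L))) * (norm (mean_grad n L \<theta> H \<Delta> - grad F x))\<^sup>2"
proof -
  define gb where "gb = mean_grad n L \<theta> H \<Delta>"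
  define e where "e = gb - grad F x"
  define s where "s = aggregate n \<Delta> w"
  define u where "u = (\<lambda>i::nat. 1 / real n)"
  have lg: "local_grad L \<theta> H \<Delta> i = - (L / \<theta>) *\<^sub>R \<Delta> i" if "i < n" for i
    using H[OF that] L \<theta> unfolding local_grad_def local_step_def by simp
  have agg: "aggregate n \<Delta> u = - (\<theta> / L) *\<^sub>R gb"
  proof -
    have "gb = - (L / \<theta>) *\<^sub>R ((1 / real n) *\<^sub>R (\<Sum>i<n. \<Delta> i))"
      unfolding gb_def mean_grad_def by (simp add: lg scaleR_right.sum[symmetric] sum_negf)
    then show ?thesis using L \<theta> unfolding aggregate_def u_def
      by (simp add: scaleR_right.sum[symmetric])
  qed
  have "u \<in> simplex_weights n" unfolding u_def simplex_weights_def using n by simp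
  then have "\<Psi>_hom n L \<theta> \<Lambda> H \<Delta> w \<le> \<Psi>_hom n L \<theta> \<Lambda> H \<Delta> u"
    using w unfolding is_arg_min_def by (meson not_le)
  also have "\<dots> = - (\<theta> / L) * (norm gb)\<^sup>2 + (\<Lambda> * \<theta>) * (\<theta> / (2 * L\<^sup>2)) * (norm gb)\<^sup>2"
    unfolding \<Psi>_hom_def agg gb_def[symmetric] using L \<theta>
    by (simp add: dot_square_norm power_mult_distrib power_divide power2_eq_square mult_ac)
  also have "\<dots> \<le> - (\<theta> / L) * (norm gb)\<^sup>2 + (L / 2) * (\<theta> / (2 * L\<^sup>2)) * (norm gb)\<^sup>2"
    using \<theta> L by (intro add_left_mono mult_right_mono) auto
  also have "\<dots> = - (3 * \<theta> / (4 * L)) * (norm gb)\<^sup>2"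
    using L by (simp add: field_simps power2_eq_square)
  \<comment> \<open>Only the fraction \<open>1 / 2\<close> is kept: a larger one would cost a larger multiple of \<open>(norm e)\<^sup>2\<close> when
    \<open>gb\<close> is exchanged for the gradient below.\<close>
  also have "\<dots> \<le> - (\<theta> / (2 * L)) * (norm gb)\<^sup>2"
    using L \<theta> by (intro mult_right_mono) (auto simp: field_simps)
  finally have \<Psi>: "gb \<bullet> s + \<Lambda> / 2 * (norm s)\<^sup>2 \<le> - (\<theta> / (2 * L)) * (norm gb)\<^sup>2"
    unfolding \<Psi>_hom_def gb_def s_def .
  have young: "- (e \<bullet> s) - (\<Lambda> - L) / 2 * (norm s)\<^sup>2 \<le> 1 / (2 * (\<Lambda> - L)) * (norm e)\<^sup>2"
  proof -
    define c where "c = \<Lambda> - L"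
    have c: "c > 0" using L unfolding c_def by simp
    have "0 \<le> 1 / (2 * c) * (norm (e + c *\<^sub>R s))\<^sup>2" using c by simp
    also have "\<dots> = 1 / (2 * c) * (norm e)\<^sup>2 + e \<bullet> s + c / 2 * (norm s)\<^sup>2"
      using c by (simp add: power2_norm_eq_inner inner_add inner_commute field_simps)
    finally show ?thesis unfolding c_def by simp
  qed
  have gF: "(norm (grad F x))\<^sup>2 \<le> 2 * (norm gb)\<^sup>2 + 2 * (norm e)\<^sup>2"
    using norm_add_sq_le[of gb "- e"] unfolding e_def by (simp add: norm_minus_commute)
  have "F (x + s) \<le> F x + grad F x \<bullet> s + L / 2 * (norm s)\<^sup>2" by (rule smooth_upper_bound[OF sm])
  also have "\<dots> = F x + (gb \<bullet> s + \<Lambda> / 2 * (norm s)\<^sup>2) + (- (e \<bullet> s) - (\<Lambda> - L) / 2 * (norm s)\<^sup>2)"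
    unfolding e_def by (simp add: inner_diff_left algebra_simps diff_divide_distrib)
  also have "\<dots> \<le> F x - (\<theta> / (2 * L)) * (norm gb)\<^sup>2 + 1 / (2 * (\<Lambda> - L)) * (norm e)\<^sup>2"
    using \<Psi> young by simp
  also have "\<dots> \<le> F x - (\<theta> / (4 * L)) * (norm (grad F x))\<^sup>2
      + (\<theta> / (2 * L) + 1 / (2 * (\<Lambda> - L))) * (norm e)\<^sup>2"
  proof -
    have "\<theta> / (4 * L) * (norm (grad F x))\<^sup>2 \<le> \<theta> / (4 * L) * (2 * (norm gb)\<^sup>2 + 2 * (norm e)\<^sup>2)"
      using gF L \<theta> by (intro mult_left_mono) auto
    then show ?thesis by (simp add: algebra_simps)
  qed
  finally show ?thesis unfolding s_def e_def gb_def .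
qed

text \<open>One round in terms of the increments \<open>\<xi>\<close> alone: the square of their average over all nodes, and
  the squares of the partial sums within each node that the drift produces.\<close>

lemma round_decrease:
  fixes y g :: "nat \<Rightarrow> nat \<Rightarrow> 'a::real_inner" and F :: "'a \<Rightarrow> real"
  defines "\<xi> \<equiv> (\<lambda>i l. g i l - grad F (y i l))"
  assumes sm: "smooth L F" and n: "n \<ge> 1" and H: "\<And>i. i < n \<Longrightarrow> H i \<ge> 1"
    and L: "0 < L" "L < \<Lambda>" and \<theta>: "0 < \<theta>" "\<Lambda> * \<theta> \<le> L / 2"
    and y0: "\<And>i. i < n \<Longrightarrow> y i 0 = x"
    and step: "\<And>i l. i < n \<Longrightarrow> l < H i \<Longrightarrow> y i (Suc l) = y i l - local_step L \<theta> (H i) *\<^sub>R g i l"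
    and w: "is_arg_min (\<Psi>_hom n L \<theta> \<Lambda> H (\<lambda>i. y i (H i) - x)) (\<lambda>u. u \<in> simplex_weights n) w"
  shows "F (x + aggregate n (\<lambda>i. y i (H i) - x) w) \<le> F x - \<theta> / (4 * L) * (norm (grad F x))\<^sup>2
    + (\<theta> / L + 1 / (\<Lambda> - L)) *
      ((norm ((1 / real n) *\<^sub>R (\<Sum>i<n. (1 / real (H i)) *\<^sub>R (\<Sum>l<H i. \<xi> i l))))\<^sup>2
       + (1 / real n) * (\<Sum>i<n. 4 * \<theta>\<^sup>2 / (real (H i))^3 * (\<Sum>l<H i. (norm (\<Sum>k<l. \<xi> i k))\<^sup>2))
       + 4 * \<theta>\<^sup>2 * (norm (grad F x))\<^sup>2)"
proof -
  define \<Delta> where "\<Delta> i = y i (H i) - x" for i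
  define noise where "noise = (1 / real n) *\<^sub>R (\<Sum>i<n. (1 / real (H i)) *\<^sub>R (\<Sum>l<H i. \<xi> i l))"
  define bi where "bi i = (1 / real (H i)) *\<^sub>R (\<Sum>l<H i. grad F (y i l) - grad F x)" for i
  define bias where "bias = (1 / real n) *\<^sub>R (\<Sum>i<n. bi i)"
  define T where "T i = 4 * \<theta>\<^sup>2 / (real (H i))^3 * (\<Sum>l<H i. (norm (\<Sum>k<l. \<xi> i k))\<^sup>2)" for i
  define Tn where "Tn = (1 / real n) * (\<Sum>i<n. T i)"
  define G where "G = (norm (grad F x))\<^sup>2"
  have tele: "y i l - x = - (local_step L \<theta> (H i) *\<^sub>R (\<Sum>k<l. g i k))" if "i < n" "l \<le> H i" for i l
    using that(2)
  proof (induction l)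
    case (Suc l)
    then have "y i (Suc l) - x = (y i l - x) - local_step L \<theta> (H i) *\<^sub>R g i l"
      using step[OF that(1), of l] by simp
    then show ?case using Suc by (simp add: algebra_simps)
  qed (simp add: y0 that)
  have lg: "local_grad L \<theta> H \<Delta> i = (1 / real (H i)) *\<^sub>R (\<Sum>l<H i. \<xi> i l) + bi i + grad F x"
    if "i < n" for i
  proof -
    have "local_grad L \<theta> H \<Delta> i = (1 / real (H i)) *\<^sub>R (\<Sum>l<H i. g i l)"
      using H[OF that] L \<theta> tele[OF that, of "H i"] unfolding local_grad_def \<Delta>_def local_step_def
      by simp
    then show ?thesis using H[OF that] unfolding \<xi>_def bi_def
      by (simp add: sum_subtractf scaleR_diff_right sum_constant_scaleR del: sum_constant)
  qed
  have err: "mean_grad n L \<theta> H \<Delta> - grad F x = noise + bias"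
    using n unfolding mean_grad_def noise_def bias_def
    by (simp add: lg sum.distrib scaleR_add_right sum_constant_scaleR del: sum_constant)
  have "\<Lambda> * \<theta> < \<Lambda> / 2" using \<theta> L by linarith
  then have "\<theta> < 1 / 2" using L by (simp add: field_simps)
  then have \<theta>4: "\<theta>\<^sup>2 \<le> 1 / 4"
    using power_mono[of \<theta> "1/2" 2] \<theta> by (simp add: power_divide)
  have bi: "(norm (bi i))\<^sup>2 \<le> T i + 4 * \<theta>\<^sup>2 * G" if "i < n" for i
  proof -
    define A where "A = L\<^sup>2 * (\<Sum>l<H i. (norm (y i l - x))\<^sup>2)"
    have h: "real (H i) > 0" using H[OF that] by simp
    have st: "local_step L \<theta> (H i) * L = \<theta> / real (H i)" "\<theta> / real (H i) * real (H i) = \<theta>"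
      using h L unfolding local_step_def by auto
    have "(norm (bi i))\<^sup>2 \<le> (1 / real (H i)) * (\<Sum>l<H i. (norm (grad F (y i l) - grad F x))\<^sup>2)"
      unfolding bi_def by (intro norm_average_sq_le H that)
    also have "\<dots> \<le> (1 / real (H i)) * (\<Sum>l<H i. (L * norm (y i l - x))\<^sup>2)"
      using smooth_grad_diff[OF sm] by (intro mult_left_mono sum_mono power_mono) auto
    also have "\<dots> = (1 / real (H i)) * A"
      unfolding A_def by (simp add: power_mult_distrib sum_distrib_left)
    also have "\<dots> \<le> (1 / real (H i)) * (4 * (\<theta> / real (H i))\<^sup>2 * (\<Sum>l<H i. (norm (\<Sum>k<l. \<xi> i k))\<^sup>2)
        + 4 * \<theta>\<^sup>2 * (real (H i) * G))"
    proof (intro mult_left_mono)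
      have "(local_step L \<theta> (H i) * L * real (H i))\<^sup>2 \<le> 1 / 4" unfolding st by (rule \<theta>4)
      from local_drift_bound[OF sm this y0[OF that] step[OF that]]
      show "A \<le> 4 * (\<theta> / real (H i))\<^sup>2 * (\<Sum>l<H i. (norm (\<Sum>k<l. \<xi> i k))\<^sup>2)
          + 4 * \<theta>\<^sup>2 * (real (H i) * G)"
        unfolding A_def G_def \<xi>_def st .
    qed simp
    also have "\<dots> = T i + 4 * \<theta>\<^sup>2 * G"
      using h unfolding T_def by (simp add: field_simps power2_eq_square power3_eq_cube)
    finally show ?thesis .
  qed
  have "(norm bias)\<^sup>2 \<le> (1 / real n) * (\<Sum>i<n. (norm (bi i))\<^sup>2)"
    unfolding bias_def by (rule norm_average_sq_le[OF n])
  also have "\<dots> \<le> (1 / real n) * (\<Sum>i<n. T i + 4 * \<theta>\<^sup>2 * G)"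
    using bi by (intro mult_left_mono sum_mono) auto
  also have "\<dots> = Tn + 4 * \<theta>\<^sup>2 * G"
    using n unfolding Tn_def by (simp add: sum.distrib field_simps)
  finally have "(norm (noise + bias))\<^sup>2
      \<le> 2 * ((norm noise)\<^sup>2 + Tn + 4 * \<theta>\<^sup>2 * G)"
    using norm_add_sq_le[of noise bias] by (simp add: algebra_simps)
  then have "(\<theta> / (2 * L) + 1 / (2 * (\<Lambda> - L))) * (norm (noise + bias))\<^sup>2
      \<le> (\<theta> / (2 * L) + 1 / (2 * (\<Lambda> - L))) *
        (2 * ((norm noise)\<^sup>2 + Tn + 4 * \<theta>\<^sup>2 * G))"
    using L \<theta> by (intro mult_left_mono) auto
  also have "\<dots> = (\<theta> / L + 1 / (\<Lambda> - L)) *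
      ((norm noise)\<^sup>2 + Tn + 4 * \<theta>\<^sup>2 * G)"
    using L by (simp add: field_simps)
  finally show ?thesis
    using server_decrease[where H = H and \<Delta> = \<Delta> and w = w and x = x, OF sm n H L \<theta>] w
    unfolding err \<Delta>_def[symmetric] noise_def Tn_def T_def G_def by linarith
qed

section \<open>Conditional independence and centred increments\<close>

text \<open>Two integrable densities that agree on a \<open>\<pi>\<close>-system containing the whole space agree on the
  generated \<open>\<sigma>\<close>-algebra.\<close>

lemma set_integral_eq_on_sigma_sets:
  fixes f g :: "'w \<Rightarrow> real"
  assumes f: "integrable M f" and g: "integrable M g"
    and P: "Int_stable P" "P \<subseteq> sets M" "space M \<in> P"
    and eq: "\<And>A. A \<in> P \<Longrightarrow> (LINT x:A|M. f x) = (LINT x:A|M. g x)"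
    and A: "A \<in> sigma_sets (space M) P"
  shows "(LINT x:A|M. f x) = (LINT x:A|M. g x)"
proof -
  have sub: "sigma_sets (space M) P \<subseteq> sets M"
    using sets.sigma_sets_subset[OF P(2)] .
  have int: "set_integrable M B f" "set_integrable M B g" if "B \<in> sets M" for B
    using f g that unfolding set_integrable_def by (blast intro: integrable_mult_indicator)+
  have Pow: "P \<subseteq> Pow (space M)" using P(2) sets.space_closed by blast
  from P(1) Pow A show ?thesis
  proof (induction rule: sigma_sets_induct_disjoint)
    case (basic A)
    then show ?case by (rule eq)
  next
    case empty
    show ?case by (simp add: set_lebesgue_integral_def)
  next
    case (compl A)
    have A: "A \<in> sets M" using compl sub by blast
    have "(LINT x:space M|M. h x) = (LINT x:A|M. h x) + (LINT x:space M - A|M. h x)"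
      if "\<And>B. B \<in> sets M \<Longrightarrow> set_integrable M B h" for h :: "'w \<Rightarrow> real"
    proof -
      have "A \<union> (space M - A) = space M" using sets.sets_into_space[OF A] by blast
      then show ?thesis
        using set_integral_Un[of A "space M - A" M h] that[OF A] that[of "space M - A"] A by simp
    qed
    from this[of f] this[of g] show ?case using eq[OF P(3)] compl int by simp
  next
    case (union A)
    have A: "A i \<in> sets M" for i using union sub by blast
    have "A i \<inter> A j = {}" if "i \<noteq> j" for i j
      using union(1) that unfolding disjoint_family_on_def by blast
    then show ?case
      using lebesgue_integral_countable_add[of A M f] lebesgue_integral_countable_add[of A M g]
        A int[of "\<Union>i. A i"] union(3) by (simp add: sets.countable_UN)
  qed
qed

lemma (in prob_space) sigma_finite_subalgebraI:
  "subalgebra M F \<Longrightarrow> sigma_finite_subalgebra M F"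
  by (simp add: finite_measure_subalgebra_is_sigma_finite finite_measure_subalgebra_def
      finite_measure_subalgebra_axioms_def finite_measure_axioms)

lemma (in prob_space) integrable_indicat_real:
  "D \<in> events \<Longrightarrow> integrable M (indicat_real D)"
  by (rule integrable_const_bound[where B = 1]) (auto simp: indicator_def)

lemma (in prob_space) real_cond_exp_bounded:
  assumes F: "subalgebra M F" and D: "D \<in> events"
  shows "AE x in M. norm (real_cond_exp M F (indicat_real D) x) \<le> 1"
proof -
  interpret sigma_finite_subalgebra M F by (rule sigma_finite_subalgebraI[OF F])
  have i: "integrable M (indicat_real D)" using D by (simp add: integrable_indicat_real)
  have "AE x in M. real_cond_exp M F (indicat_real D) x \<ge> 0"
    by (rule real_cond_exp_ge_c[OF i]) simp
  moreover have "AE x in M. real_cond_exp M F (indicat_real D) x \<le> 1"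
    by (rule real_cond_exp_le_c[OF i]) (simp add: indicator_def)
  ultimately show ?thesis by eventually_elim auto
qed

lemma (in prob_space) real_cond_exp_zero_subalgebra:
  assumes G: "subalgebra M G" "subalgebra G F" and f: "integrable M f"
    and 0: "AE \<omega> in M. real_cond_exp M G f \<omega> = 0"
  shows "AE \<omega> in M. real_cond_exp M F f \<omega> = 0"
proof -
  have F: "subalgebra M F" using G unfolding subalgebra_def by auto
  interpret F: sigma_finite_subalgebra M F by (rule sigma_finite_subalgebraI[OF F])
  have "AE \<omega> in M. real_cond_exp M F (real_cond_exp M G f) \<omega> = real_cond_exp M F f \<omega>"
    by (rule F.real_cond_exp_nested_subalg[OF G f])
  moreover have "AE \<omega> in M. real_cond_exp M F (real_cond_exp M G f) \<omega> = real_cond_exp M F (\<lambda>_. 0) \<omega>"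
    by (rule F.real_cond_exp_cong[OF 0 borel_measurable_cond_exp2 borel_measurable_const])
  moreover have "AE \<omega> in M. real_cond_exp M F (\<lambda>_. 0) \<omega> = 0"
    by (rule F.real_cond_exp_F_meas[OF integrable_zero borel_measurable_const])
  ultimately show ?thesis by eventually_elim simp
qed

text \<open>Let \<open>G1\<close> and \<open>G2\<close> both extend \<open>F\<close>, by \<open>\<pi>\<close>-systems \<open>P1\<close> and \<open>P2\<close> that are independent given \<open>F\<close>.
  Then a \<open>G1\<close>-measurable variable that is centred given \<open>F\<close> is centred given \<open>G2\<close>.\<close>

lemma (in prob_space) cond_indep_zero_mean:
  fixes X :: "'a \<Rightarrow> real"
  assumes F: "subalgebra M F" "subalgebra G1 F" and G1: "subalgebra M G1" and G2: "subalgebra M G2"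
    and P1: "P1 \<subseteq> events" "Int_stable P1" "space M \<in> P1"
    and P2: "P2 \<subseteq> events" "Int_stable P2" "space M \<in> P2"
    and gen1: "sets G1 = sigma_sets (space M) {A \<inter> D |A D. A \<in> sets F \<and> D \<in> P1}"
    and gen2: "sets G2 = sigma_sets (space M) {A \<inter> D |A D. A \<in> sets F \<and> D \<in> P2}"
    and indep: "\<And>D E. D \<in> P1 \<Longrightarrow> E \<in> P2 \<Longrightarrow>
      AE \<omega> in M. cond_prob M F (D \<inter> E) \<omega> = cond_prob M F D \<omega> * cond_prob M F E \<omega>"
    and X: "integrable M X" "X \<in> borel_measurable G1"
    and X0: "AE \<omega> in M. real_cond_exp M F X \<omega> = 0"
  shows "AE \<omega> in M. real_cond_exp M G2 X \<omega> = 0"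
proof -
  interpret F: sigma_finite_subalgebra M F by (rule sigma_finite_subalgebraI[OF F(1)])
  interpret G1: sigma_finite_subalgebra M G1 by (rule sigma_finite_subalgebraI[OF G1])
  interpret G2: sigma_finite_subalgebra M G2 by (rule sigma_finite_subalgebraI[OF G2])
  have FM: "A \<in> events" if "A \<in> sets F" for A using F(1) that unfolding subalgebra_def by blast
  have Fsp: "space M \<in> sets F" using F(1) unfolding subalgebra_def by (metis sets.top)
  have pi: "Int_stable {A \<inter> D |A D. A \<in> sets F \<and> D \<in> P}" "{A \<inter> D |A D. A \<in> sets F \<and> D \<in> P} \<subseteq> events"
    "space M \<in> {A \<inter> D |A D. A \<in> sets F \<and> D \<in> P}"
    if P: "P \<subseteq> events" "Int_stable P" "space M \<in> P" for P
  proof -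
    show "Int_stable {A \<inter> D |A D. A \<in> sets F \<and> D \<in> P}"
    proof (rule Int_stableI, clarify)
      fix A D B E assume *: "A \<in> sets F" "D \<in> P" "B \<in> sets F" "E \<in> P"
      have "A \<inter> D \<inter> (B \<inter> E) = (A \<inter> B) \<inter> (D \<inter> E)" by blast
      moreover have "D \<inter> E \<in> P" using P(2) * unfolding Int_stable_def by blast
      ultimately show "\<exists>A' D'. A \<inter> D \<inter> (B \<inter> E) = A' \<inter> D' \<and> A' \<in> sets F \<and> D' \<in> P"
        using * by blast
    qed
    show "{A \<inter> D |A D. A \<in> sets F \<and> D \<in> P} \<subseteq> events" using P(1) FM by blast
    show "space M \<in> {A \<inter> D |A D. A \<in> sets F \<and> D \<in> P}" using Fsp P(3) by blast
  qed
  \<comment> \<open>Knowing \<open>G1\<close> instead of \<open>F\<close> does not change the conditional probability of an event of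
    \<open>P2\<close>.\<close>
  have refine: "AE \<omega> in M. real_cond_exp M G1 (indicat_real E) \<omega> = real_cond_exp M F (indicat_real E) \<omega>"
    if E: "E \<in> P2" for E
  proof (rule G1.real_cond_exp_charact)
    have EM: "E \<in> events" using E P2 by blast
    show iE: "integrable M (indicat_real E)" using EM by (simp add: integrable_indicat_real)
    show iFE: "integrable M (real_cond_exp M F (indicat_real E))"
      by (rule F.real_cond_exp_int(1)[OF iE])
    show "real_cond_exp M F (indicat_real E) \<in> borel_measurable G1"
      using F(2) by (rule measurable_from_subalg) simp
    fix A assume "A \<in> sets G1"
    then have A: "A \<in> sigma_sets (space M) {A \<inter> D |A D. A \<in> sets F \<and> D \<in> P1}" using gen1 by simp
    show "(LINT x:A|M. indicat_real E x) = (LINT x:A|M. real_cond_exp M F (indicat_real E) x)"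
      using iE iFE pi[OF P1] _ A
    proof (rule set_integral_eq_on_sigma_sets)
      fix A assume "A \<in> {A \<inter> D |A D. A \<in> sets F \<and> D \<in> P1}"
      then obtain B D where A: "A = B \<inter> D" "B \<in> sets F" "D \<in> P1" by blast
      have DM: "D \<in> events" using A P1 by blast
      have iD: "integrable M (indicat_real D)" "integrable M (indicat_real (D \<inter> E))"
        using DM EM by (simp_all add: integrable_indicat_real)
      have bd: "AE x in M. norm (real_cond_exp M F (indicat_real E) x) \<le> 1"
        by (rule real_cond_exp_bounded[OF F(1) EM])
      have iP: "integrable M (\<lambda>x. indicat_real B x * real_cond_exp M F (indicat_real E) x * indicat_real D x)"
        using FM[OF A(2)] DM bd
        by (intro integrable_const_bound[where B = 1]) (auto elim!: eventually_mono simp: indicator_def)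
      have "(LINT x:A|M. indicat_real E x) = (LINT x:B|M. indicat_real (D \<inter> E) x)"
        unfolding set_lebesgue_integral_def A by (simp add: indicator_inter_arith mult.assoc)
      also have "\<dots> = (LINT x:B|M. real_cond_exp M F (indicat_real (D \<inter> E)) x)"
        by (rule F.real_cond_exp_intA[OF iD(2) A(2)])
      also have "\<dots> = (\<integral>x. (indicat_real B x * real_cond_exp M F (indicat_real E) x)
          * real_cond_exp M F (indicat_real D) x \<partial>M)"
        unfolding set_lebesgue_integral_def
        using indep[OF A(3) E] FM[OF A(2)] unfolding cond_prob_def
        by (intro integral_cong_AE) (auto elim!: eventually_mono)
      also have "\<dots> = (\<integral>x. (indicat_real B x * real_cond_exp M F (indicat_real E) x) * indicat_real D x \<partial>M)"
        using iP A(2) DM by (intro F.real_cond_exp_intg(2)) auto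
      also have "\<dots> = (LINT x:A|M. real_cond_exp M F (indicat_real E) x)"
        unfolding set_lebesgue_integral_def A by (simp add: indicator_inter_arith mult_ac)
      finally show "(LINT x:A|M. indicat_real E x) = (LINT x:A|M. real_cond_exp M F (indicat_real E) x)" .
    qed
  qed
  \<comment> \<open>On a generator \<open>B \<inter> E\<close> of \<open>G2\<close>, project \<open>E\<close> first to \<open>G1\<close>, which is the same as projecting it to
    \<open>F\<close>, and then \<open>X\<close> to \<open>F\<close>.\<close>
  show ?thesis
  proof (rule G2.real_cond_exp_charact)
    show "integrable M X" by (rule X)
    show "integrable M (\<lambda>_. 0 :: real)" "(\<lambda>_. 0 :: real) \<in> borel_measurable G2" by simp_all
    fix A assume "A \<in> sets G2"
    then have A: "A \<in> sigma_sets (space M) {A \<inter> D |A D. A \<in> sets F \<and> D \<in> P2}" using gen2 by simp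
    show "(LINT x:A|M. X x) = (LINT x:A|M. 0)"
      using X(1) _ pi[OF P2] _ A
    proof (rule set_integral_eq_on_sigma_sets)
      fix A assume "A \<in> {A \<inter> D |A D. A \<in> sets F \<and> D \<in> P2}"
      then obtain B E where A: "A = B \<inter> E" "B \<in> sets F" "E \<in> P2" by blast
      have EM: "E \<in> events" using A P2 by blast
      have BG: "B \<in> sets G1" using F(2) A(2) unfolding subalgebra_def by blast
      have BX: "(\<lambda>x. indicat_real B x * X x) \<in> borel_measurable G1" using BG X(2) by simp
      have XM: "X \<in> borel_measurable M" using X(1) by simp
      have BM: "B \<in> events" using FM A(2) .
      have bd: "AE x in M. norm (real_cond_exp M F (indicat_real E) x) \<le> 1"
        by (rule real_cond_exp_bounded[OF F(1) EM])
      have i1: "integrable M (\<lambda>x. (indicat_real B x * X x) * indicat_real E x)"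
        using X(1) BM EM
        by (intro Bochner_Integration.integrable_bound[OF X(1)]) (auto simp: indicator_def)
      have i2: "integrable M (\<lambda>x. (indicat_real B x * real_cond_exp M F (indicat_real E) x) * X x)"
        using X(1) BM bd
        by (intro Bochner_Integration.integrable_bound[OF X(1)])
          (auto elim!: eventually_mono simp: indicator_def abs_mult mult_left_le_one_le)
      have "(LINT x:A|M. X x) = (\<integral>x. (indicat_real B x * X x) * indicat_real E x \<partial>M)"
        unfolding set_lebesgue_integral_def A by (simp add: indicator_inter_arith mult_ac)
      also have "\<dots> = (\<integral>x. (indicat_real B x * X x) * real_cond_exp M G1 (indicat_real E) x \<partial>M)"
        using EM by (intro G1.real_cond_exp_intg(2)[symmetric] i1 BX) simp
      also have "\<dots> = (\<integral>x. (indicat_real B x * real_cond_exp M F (indicat_real E) x) * X x \<partial>M)"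
        using refine[OF A(3)] BM XM by (intro integral_cong_AE) (auto elim!: eventually_mono)
      also have "\<dots> = (\<integral>x. (indicat_real B x * real_cond_exp M F (indicat_real E) x)
          * real_cond_exp M F X x \<partial>M)"
        using A(2) XM by (intro F.real_cond_exp_intg(2)[symmetric] i2) simp_all
      also have "\<dots> = (\<integral>x. 0 \<partial>M)"
        using X0 BM by (intro integral_cong_AE) (auto elim!: eventually_mono)
      finally show "(LINT x:A|M. X x) = (LINT x:A|M. 0)" by (simp add: set_lebesgue_integral_def)
    qed simp
  qed
qed

text \<open>A bounded vector that is centred given \<open>G\<close> is orthogonal to every bounded \<open>G\<close>-measurable
  vector.\<close>

lemma (in prob_space) cond_centred_orthogonal:
  fixes X Z :: "'a \<Rightarrow> 'b::euclidean_space"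
  assumes G: "subalgebra M G" and X: "X \<in> borel_measurable M" "AE \<omega> in M. norm (X \<omega>) \<le> C"
    and Z: "Z \<in> borel_measurable G" "AE \<omega> in M. norm (Z \<omega>) \<le> D"
    and X0: "\<And>e. e \<in> Basis \<Longrightarrow> AE \<omega> in M. real_cond_exp M G (\<lambda>\<omega>. X \<omega> \<bullet> e) \<omega> = 0"
  shows "(\<integral>\<omega>. X \<omega> \<bullet> Z \<omega> \<partial>M) = 0"
proof -
  interpret G: sigma_finite_subalgebra M G by (rule sigma_finite_subalgebraI[OF G])
  have ZM: "Z \<in> borel_measurable M" by (rule measurable_from_subalg[OF G Z(1)])
  have ie: "integrable M (\<lambda>\<omega>. (Z \<omega> \<bullet> e) * (X \<omega> \<bullet> e))" if e: "e \<in> Basis" for e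
  proof (rule integrable_const_bound)
    show "AE \<omega> in M. norm ((Z \<omega> \<bullet> e) * (X \<omega> \<bullet> e)) \<le> D * C"
      using X(2) Z(2)
    proof eventually_elim
      case (elim \<omega>)
      have "\<bar>Z \<omega> \<bullet> e\<bar> \<le> D" "\<bar>X \<omega> \<bullet> e\<bar> \<le> C"
        using elim Basis_le_norm[OF e, of "Z \<omega>"] Basis_le_norm[OF e, of "X \<omega>"] by linarith+
      then show ?case unfolding real_norm_def abs_mult by (intro mult_mono) auto
    qed
  qed (use ZM X in measurable)
  have "(\<integral>\<omega>. X \<omega> \<bullet> Z \<omega> \<partial>M) = (\<integral>\<omega>. (\<Sum>e\<in>Basis. (Z \<omega> \<bullet> e) * (X \<omega> \<bullet> e)) \<partial>M)"
    by (subst euclidean_inner) (simp add: mult.commute)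
  also have "\<dots> = (\<Sum>e\<in>Basis. \<integral>\<omega>. (Z \<omega> \<bullet> e) * (X \<omega> \<bullet> e) \<partial>M)"
    by (intro Bochner_Integration.integral_sum ie)
  also have "\<dots> = 0"
  proof (intro sum.neutral ballI)
    fix e :: 'b assume e: "e \<in> Basis"
    have "(\<integral>\<omega>. (Z \<omega> \<bullet> e) * (X \<omega> \<bullet> e) \<partial>M)
        = (\<integral>\<omega>. (Z \<omega> \<bullet> e) * real_cond_exp M G (\<lambda>\<omega>. X \<omega> \<bullet> e) \<omega> \<partial>M)"
      using Z(1) X(1) by (intro G.real_cond_exp_intg(2)[symmetric] ie e) simp_all
    also have "\<dots> = (\<integral>\<omega>. 0 \<partial>M)"
      using X0[OF e] ZM by (intro integral_cong_AE) (auto elim!: eventually_mono)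
    finally show "(\<integral>\<omega>. (Z \<omega> \<bullet> e) * (X \<omega> \<bullet> e) \<partial>M) = 0" by simp
  qed
  finally show ?thesis .
qed

lemma integral_norm_sum_orthogonal:
  fixes \<xi> :: "'k \<Rightarrow> 'w \<Rightarrow> 'a::real_inner" and c :: "'k \<Rightarrow> real"
  assumes K: "finite K"
    and int: "\<And>k k'. k \<in> K \<Longrightarrow> k' \<in> K \<Longrightarrow> integrable M (\<lambda>\<omega>. \<xi> k \<omega> \<bullet> \<xi> k' \<omega>)"
    and orth: "\<And>k k'. k \<in> K \<Longrightarrow> k' \<in> K \<Longrightarrow> k \<noteq> k' \<Longrightarrow> (\<integral>\<omega>. \<xi> k \<omega> \<bullet> \<xi> k' \<omega> \<partial>M) = 0"
  shows "integrable M (\<lambda>\<omega>. (norm (\<Sum>k\<in>K. c k *\<^sub>R \<xi> k \<omega>))\<^sup>2)"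
    and "(\<integral>\<omega>. (norm (\<Sum>k\<in>K. c k *\<^sub>R \<xi> k \<omega>))\<^sup>2 \<partial>M) = (\<Sum>k\<in>K. (c k)\<^sup>2 * (\<integral>\<omega>. (norm (\<xi> k \<omega>))\<^sup>2 \<partial>M))"
proof -
  have expand: "(norm (\<Sum>k\<in>K. c k *\<^sub>R \<xi> k \<omega>))\<^sup>2
      = (\<Sum>k\<in>K. \<Sum>k'\<in>K. (c k * c k') * (\<xi> k \<omega> \<bullet> \<xi> k' \<omega>))" for \<omega>
    unfolding power2_norm_eq_inner inner_sum_left inner_sum_right by (simp add: mult_ac inner_commute)
  show "integrable M (\<lambda>\<omega>. (norm (\<Sum>k\<in>K. c k *\<^sub>R \<xi> k \<omega>))\<^sup>2)"
    unfolding expand by (intro Bochner_Integration.integrable_sum integrable_mult_right int)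
  have "(\<integral>\<omega>. (norm (\<Sum>k\<in>K. c k *\<^sub>R \<xi> k \<omega>))\<^sup>2 \<partial>M)
      = (\<Sum>k\<in>K. \<Sum>k'\<in>K. (c k * c k') * (\<integral>\<omega>. \<xi> k \<omega> \<bullet> \<xi> k' \<omega> \<partial>M))"
    unfolding expand using int by (simp add: Bochner_Integration.integral_sum)
  also have "\<dots> = (\<Sum>k\<in>K. \<Sum>k'\<in>K. if k' = k then (c k * c k) * (\<integral>\<omega>. \<xi> k \<omega> \<bullet> \<xi> k \<omega> \<partial>M) else 0)"
    using orth by (intro sum.cong refl) (simp split: if_split)
  also have "\<dots> = (\<Sum>k\<in>K. (c k)\<^sup>2 * (\<integral>\<omega>. (norm (\<xi> k \<omega>))\<^sup>2 \<partial>M))"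
    unfolding power2_norm_eq_inner power2_eq_square[of "c _"] using K by simp
  finally show "(\<integral>\<omega>. (norm (\<Sum>k\<in>K. c k *\<^sub>R \<xi> k \<omega>))\<^sup>2 \<partial>M)
      = (\<Sum>k\<in>K. (c k)\<^sup>2 * (\<integral>\<omega>. (norm (\<xi> k \<omega>))\<^sup>2 \<partial>M))" .
qed

lemma (in prob_space) integral_le_of_nn_cond_exp_le:
  assumes F: "subalgebra M F" and f: "integrable M f" "\<And>\<omega>. 0 \<le> f \<omega>" and "0 \<le> c"
    and le: "AE \<omega> in M. nn_cond_exp M F (\<lambda>\<omega>. ennreal (f \<omega>)) \<omega> \<le> ennreal c"
  shows "(\<integral>\<omega>. f \<omega> \<partial>M) \<le> c"
proof -
  interpret F: sigma_finite_subalgebra M F by (rule sigma_finite_subalgebraI[OF F])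
  have "(\<integral>\<^sup>+\<omega>. ennreal (f \<omega>) \<partial>M) = (\<integral>\<^sup>+\<omega>. nn_cond_exp M F (\<lambda>\<omega>. ennreal (f \<omega>)) \<omega> \<partial>M)"
    using F.nn_cond_exp_intg[of "\<lambda>_. 1" "\<lambda>\<omega>. ennreal (f \<omega>)"] f(1) by simp
  also have "\<dots> \<le> (\<integral>\<^sup>+\<omega>. ennreal c \<partial>M)" by (rule nn_integral_mono_AE[OF le])
  also have "\<dots> = ennreal c" by (simp add: emeasure_space_1)
  finally have "ennreal (\<integral>\<omega>. f \<omega> \<partial>M) \<le> ennreal c"
    using nn_integral_eq_integral[OF f(1)] f(2) by simp
  then show ?thesis using \<open>0 \<le> c\<close> by simp
qed

section \<open>Histories\<close>

text \<open>The event that the first \<open>l\<close> minibatches of node \<open>i\<close> in round \<open>t\<close> lie in prescribed sets.\<close>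

definition batch_cylinder ::
  "'w measure \<Rightarrow> (nat \<Rightarrow> nat \<Rightarrow> nat \<Rightarrow> 'w \<Rightarrow> nat multiset) \<Rightarrow> nat \<Rightarrow> nat \<Rightarrow> nat \<Rightarrow>
   (nat \<Rightarrow> nat multiset set) \<Rightarrow> 'w set" where
  "batch_cylinder M \<B> i t l S = {\<omega> \<in> space M. \<forall>k<l. \<B> i t k \<omega> \<in> S k}"

lemma space_round_hist [simp]: "space (round_hist M n H x0 \<B> t) = space M"
  unfolding round_hist_def by (simp add: space_measure_of_conv)

lemma space_local_hist [simp]: "space (local_hist M n H x0 \<B> i t l) = space M"
  unfolding local_hist_def by (simp add: space_measure_of_conv)

lemma sets_round_hist:
  "sets (round_hist M n H x0 \<B> t) = sigma_sets (space M)
     ({x0 -` A \<inter> space M | A. A \<in> sets borel} \<union>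
      {\<B> i s l -` A \<inter> space M | i s l A. i < n \<and> s < t \<and> l < H i})"
  unfolding round_hist_def by (rule sets_measure_of) blast

lemma sets_local_hist:
  "sets (local_hist M n H x0 \<B> i t l) = sigma_sets (space M)
     (sets (round_hist M n H x0 \<B> t) \<union> {\<B> i t k -` A \<inter> space M | k A. k < l})"
  unfolding local_hist_def
proof (rule sets_measure_of)
  have "sets (round_hist M n H x0 \<B> t) \<subseteq> Pow (space M)"
    using sets.space_closed[of "round_hist M n H x0 \<B> t"] by simp
  then show "sets (round_hist M n H x0 \<B> t) \<union> {\<B> i t k -` A \<inter> space M | k A. k < l} \<subseteq> Pow (space M)"
    by blast
qed

lemma sets_local_hist_0: "sets (local_hist M n H x0 \<B> i t 0) = sets (round_hist M n H x0 \<B> t)"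
  unfolding sets_local_hist using sets.sigma_sets_eq[of "round_hist M n H x0 \<B> t"] by simp

text \<open>Before its first local step, a node knows the round history and nothing else, so the choice of the
  node is immaterial.\<close>

lemma local_hist_0_eq: "local_hist M n H x0 \<B> i t 0 = local_hist M n H x0 \<B> j t 0"
  unfolding local_hist_def by simp

lemma sets_round_hist_subset:
  assumes x0: "x0 \<in> borel_measurable M"
    and \<B>: "\<And>i t l. i < n \<Longrightarrow> l < H i \<Longrightarrow> \<B> i t l \<in> measurable M (count_space UNIV)"
  shows "sets (round_hist M n H x0 \<B> t) \<subseteq> sets M"
proof -
  have "\<B> i s l -` A \<inter> space M \<in> sets M" if "i < n" "l < H i" for i s l A
    using measurable_sets[OF \<B>[OF that], of A] by simp
  then have "{\<B> i s l -` A \<inter> space M | i s l A. i < n \<and> s < t \<and> l < H i} \<subseteq> sets M" by blast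
  moreover have "{x0 -` A \<inter> space M | A. A \<in> sets borel} \<subseteq> sets M"
    using measurable_sets[OF x0] by blast
  ultimately show ?thesis
    unfolding sets_round_hist by (intro sets.sigma_sets_subset Un_least)
qed

lemma sets_round_hist_le_local_hist:
  "sets (round_hist M n H x0 \<B> t) \<subseteq> sets (local_hist M n H x0 \<B> i t l)"
  unfolding sets_local_hist by (rule subsetI, rule sigma_sets.Basic) simp

lemma sets_local_hist_mono:
  assumes "l \<le> l'"
  shows "sets (local_hist M n H x0 \<B> i t l) \<subseteq> sets (local_hist M n H x0 \<B> i t l')"
  unfolding sets_local_hist using assms by (intro sigma_sets_mono' Un_mono order_refl) (blast intro: less_le_trans)

lemma sets_round_hist_mono:
  "sets (round_hist M n H x0 \<B> t) \<subseteq> sets (round_hist M n H x0 \<B> (Suc t))"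
  unfolding sets_round_hist by (intro sigma_sets_mono' Un_mono order_refl) (blast intro: less_SucI)

lemma sets_local_hist_le_round_hist:
  assumes i: "i < n" "l \<le> H i"
  shows "sets (local_hist M n H x0 \<B> i t l) \<subseteq> sets (round_hist M n H x0 \<B> (Suc t))"
proof -
  have "{\<B> i t k -` A \<inter> space M | k A. k < l} \<subseteq> sets (round_hist M n H x0 \<B> (Suc t))"
  proof clarify
    fix k A assume "k < l"
    then have "k < H i" using i by simp
    then have "\<B> i t k -` A \<inter> space M \<in> {\<B> i s l -` A \<inter> space M | i s l A. i < n \<and> s < Suc t \<and> l < H i}"
      using i(1) by blast
    then show "\<B> i t k -` A \<inter> space M \<in> sets (round_hist M n H x0 \<B> (Suc t))"
      unfolding sets_round_hist by (intro sigma_sets.Basic) blast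
  qed
  from sets.sigma_sets_subset[OF Un_least[OF sets_round_hist_mono this]] show ?thesis
    by (simp only: sets_local_hist space_round_hist)
qed

lemma sets_local_hist_subset:
  assumes x0: "x0 \<in> borel_measurable M"
    and \<B>: "\<And>i t l. i < n \<Longrightarrow> l < H i \<Longrightarrow> \<B> i t l \<in> measurable M (count_space UNIV)"
    and i: "i < n" "l \<le> H i"
  shows "sets (local_hist M n H x0 \<B> i t l) \<subseteq> sets M"
  using sets_local_hist_le_round_hist[where n = n and H = H, OF i]
    sets_round_hist_subset[where n = n and H = H and \<B> = \<B>, OF x0 \<B>] by (rule order_trans)

lemma batch_cylinder_sets:
  "batch_cylinder M \<B> i t l S \<in> sets (local_hist M n H x0 \<B> i t l)"
proof -
  let ?G = "local_hist M n H x0 \<B> i t l"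
  have "{\<omega> \<in> space ?G. \<B> i t k \<omega> \<in> S k} \<in> sets ?G" if "k < l" for k
  proof -
    have "{\<omega> \<in> space ?G. \<B> i t k \<omega> \<in> S k} = \<B> i t k -` S k \<inter> space M" by auto
    then show ?thesis unfolding sets_local_hist using that by (auto intro: sigma_sets.Basic)
  qed
  then have "{\<omega> \<in> space ?G. \<forall>k\<in>{..<l}. \<B> i t k \<omega> \<in> S k} \<in> sets ?G"
    by (intro sets.sets_Collect_finite_All) auto
  then show ?thesis by (simp only: batch_cylinder_def space_local_hist Ball_def lessThan_iff)
qed

lemma Int_stable_batch_cylinders: "Int_stable (range (batch_cylinder M \<B> i t l))"
proof (rule Int_stableI, clarify)
  fix S S'
  have "batch_cylinder M \<B> i t l S \<inter> batch_cylinder M \<B> i t l S'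
      = batch_cylinder M \<B> i t l (\<lambda>k. S k \<inter> S' k)"
    unfolding batch_cylinder_def by auto
  then show "batch_cylinder M \<B> i t l S \<inter> batch_cylinder M \<B> i t l S' \<in> range (batch_cylinder M \<B> i t l)"
    by blast
qed

lemma space_in_batch_cylinders: "space M \<in> range (batch_cylinder M \<B> i t l)"
  by (rule range_eqI[of _ _ "\<lambda>_. UNIV"]) (simp add: batch_cylinder_def)

text \<open>The round history and the cylinders of a node together generate its local history, in the form
  of a \<open>\<pi>\<close>-system.\<close>

lemma sets_local_hist_cylinders:
  "sets (local_hist M n H x0 \<B> i t l) = sigma_sets (space M)
     {A \<inter> D |A D. A \<in> sets (local_hist M n H x0 \<B> i t 0) \<and> D \<in> range (batch_cylinder M \<B> i t l)}"
    (is "sets ?G = sigma_sets _ ?P")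
proof
  have "?P \<subseteq> sets ?G"
    using sets_local_hist_mono[of 0 l M n H x0 \<B> i t]
      batch_cylinder_sets[of M \<B> i t l _ n H x0] by blast
  from sets.sigma_sets_subset[OF this] show "sigma_sets (space M) ?P \<subseteq> sets ?G" by simp
  have "sets (round_hist M n H x0 \<B> t) \<subseteq> ?P"
  proof
    fix A assume A: "A \<in> sets (round_hist M n H x0 \<B> t)"
    then have "A = A \<inter> space M" using sets.sets_into_space by fastforce
    then show "A \<in> ?P" using A space_in_batch_cylinders[of M \<B> i t l] unfolding sets_local_hist_0 by blast
  qed
  moreover have "\<B> i t k -` S \<inter> space M \<in> ?P" if "k < l" for k S
  proof -
    have "\<B> i t k -` S \<inter> space M = space M \<inter> batch_cylinder M \<B> i t l (\<lambda>k'. {B. k' = k \<longrightarrow> B \<in> S})"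
      unfolding batch_cylinder_def using that by blast
    moreover have "space M \<in> sets (local_hist M n H x0 \<B> i t 0)"
      using sets.top[of "local_hist M n H x0 \<B> i t 0"] by simp
    ultimately show ?thesis by blast
  qed
  ultimately have "sets (round_hist M n H x0 \<B> t) \<union> {\<B> i t k -` A \<inter> space M | k A. k < l} \<subseteq> ?P"
    by blast
  from sigma_sets_mono'[OF this, of "space M"] show "sets ?G \<subseteq> sigma_sets (space M) ?P"
    unfolding sets_local_hist[of M n H x0 \<B> i t l, symmetric] .
qed

text \<open>The cylinders of two nodes are intersections over disjoint blocks of a family that is independent
  given \<open>F\<close>, so their conditional probabilities multiply.\<close>

lemma batch_cylinders_cond_indep:
  assumes ind: "cond_indep_vars M F (\<lambda>_. count_space UNIV) (\<lambda>(j, k). \<B> j t k) {(j, k). j < n \<and> k < H j}"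
    and ij: "i < n" "j < n" "i \<noteq> j" and l: "l < H i" "l' < H j"
  shows "AE \<omega> in M. cond_prob M F (batch_cylinder M \<B> i t (Suc l) S \<inter> batch_cylinder M \<B> j t (Suc l') S') \<omega>
     = cond_prob M F (batch_cylinder M \<B> i t (Suc l) S) \<omega> * cond_prob M F (batch_cylinder M \<B> j t (Suc l') S') \<omega>"
proof -
  let ?X = "\<lambda>(j, k). \<B> j t k"
  define A where "A = (\<lambda>(a, k). if a = i then S k else S' k)"
  define J1 J2 where "J1 = Pair i ` {..<Suc l}" and "J2 = Pair j ` {..<Suc l'}"
  define Z where "Z = (\<lambda>p. ?X p -` A p \<inter> space M)"
  have prod: "AE \<omega> in M. cond_prob M F (\<Inter>p\<in>J. Z p) \<omega> = (\<Prod>p\<in>J. cond_prob M F (Z p) \<omega>)"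
    if "J \<noteq> {}" "finite J" "J \<subseteq> {(j, k). j < n \<and> k < H j}" for J
  proof -
    have "\<forall>p\<in>J. A p \<in> sets (count_space UNIV)" by simp
    then show ?thesis using ind that unfolding cond_indep_vars_def Z_def by blast
  qed
  have ne: "J1 \<noteq> {}" "J2 \<noteq> {}" "finite J1" "finite J2" unfolding J1_def J2_def by auto
  have K: "J1 \<subseteq> {(j, k). j < n \<and> k < H j}" "J2 \<subseteq> {(j, k). j < n \<and> k < H j}"
    unfolding J1_def J2_def using ij l by auto
  have disj: "J1 \<inter> J2 = {}" unfolding J1_def J2_def using ij by auto
  have Z1: "Z (i, k) = {\<omega> \<in> space M. \<B> i t k \<omega> \<in> S k}" for k
    unfolding Z_def A_def by auto
  have Z2: "Z (j, k) = {\<omega> \<in> space M. \<B> j t k \<omega> \<in> S' k}" for k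
    unfolding Z_def A_def using ij(3) by auto
  have D1: "(\<Inter>p\<in>J1. Z p) = batch_cylinder M \<B> i t (Suc l) S"
    unfolding J1_def image_image Z1 batch_cylinder_def by blast
  have D2: "(\<Inter>p\<in>J2. Z p) = batch_cylinder M \<B> j t (Suc l') S'"
    unfolding J2_def image_image Z2 batch_cylinder_def by blast
  have D12: "(\<Inter>p\<in>J1 \<union> J2. Z p) = batch_cylinder M \<B> i t (Suc l) S \<inter> batch_cylinder M \<B> j t (Suc l') S'"
    unfolding D1[symmetric] D2[symmetric] by (rule INT_Un)
  have "AE \<omega> in M. cond_prob M F (\<Inter>p\<in>J1 \<union> J2. Z p) \<omega> = (\<Prod>p\<in>J1 \<union> J2. cond_prob M F (Z p) \<omega>)"
    using ne K by (intro prod) auto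
  with prod[OF ne(1) ne(3) K(1)] prod[OF ne(2) ne(4) K(2)] show ?thesis
    unfolding D1 D2 D12
    by eventually_elim (simp add: prod.union_disjoint[OF ne(3) ne(4) disj])
qed

section \<open>Convergence of the local method\<close>

lemma affine_recursion_bound:
  fixes a :: "nat \<Rightarrow> real"
  assumes \<rho>: "0 < \<rho>" "\<rho> \<le> 1" and "0 \<le> \<delta>" and step: "\<And>t. a (Suc t) \<le> (1 - \<rho>) * a t + \<delta>"
  shows "a t \<le> (1 - \<rho>) ^ t * a 0 + \<delta> / \<rho>"
proof (induction t)
  case 0
  then show ?case using assms by simp
next
  case (Suc t)
  have "a (Suc t) \<le> (1 - \<rho>) * ((1 - \<rho>) ^ t * a 0 + \<delta> / \<rho>) + \<delta>"
    using step[of t] mult_left_mono[OF Suc, of "1 - \<rho>"] \<rho> by linarith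
  also have "\<dots> = (1 - \<rho>) ^ Suc t * a 0 + \<delta> / \<rho>"
    using \<rho> by (simp add: field_simps)
  finally show ?case .
qed

theorem corollary4p6:
  fixes M :: "'w measure"
    and n :: nat and m H b :: "nat \<Rightarrow> nat"
    and \<phi> :: "nat \<Rightarrow> nat \<Rightarrow> 'a::euclidean_space \<Rightarrow> real"
    and L R \<mu> \<theta>min \<theta>max :: real and xs :: 'a
    and \<theta> \<Lambda> :: "nat \<Rightarrow> real"
    and x :: "nat \<Rightarrow> 'w \<Rightarrow> 'a"
    and y g :: "nat \<Rightarrow> nat \<Rightarrow> nat \<Rightarrow> 'w \<Rightarrow> 'a"
    and \<B> :: "nat \<Rightarrow> nat \<Rightarrow> nat \<Rightarrow> 'w \<Rightarrow> nat multiset"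
    and \<Delta> :: "nat \<Rightarrow> 'w \<Rightarrow> nat \<Rightarrow> 'a"
    and w :: "nat \<Rightarrow> 'w \<Rightarrow> nat \<Rightarrow> real"
    and F :: "'a \<Rightarrow> real" and v2 :: "nat \<Rightarrow> real"
    and gap :: "nat \<Rightarrow> real" and \<delta> :: "real \<Rightarrow> real \<Rightarrow> real"
  defines "F \<equiv> obj n m \<phi>"
    and "v2 \<equiv> grad_var m \<phi> xs R"
    and "\<Delta> \<equiv> (\<lambda>t \<omega> i. y i t (H i) \<omega> - x t \<omega>)"
    and "gap \<equiv> (\<lambda>t. \<integral>\<omega>. (F (x t \<omega>) - F xs) \<partial>M)"
    and "\<delta> \<equiv> \<delta>_hom L (V_bar1 n H b v2) (V_u n H b v2)"
  assumes prob: "prob_space M"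
    \<comment> \<open>problem\<close>
    and sizes: "n \<ge> 1" "\<And>i. i < n \<Longrightarrow> m i \<ge> 1 \<and> H i \<ge> 1 \<and> b i \<ge> 1"
    and L_pos: "L > 0"
    and convex: "\<And>i j. i < n \<Longrightarrow> j < m i \<Longrightarrow> convex_on UNIV (\<phi> i j)"
    and smooth: "\<And>i j. i < n \<Longrightarrow> j < m i \<Longrightarrow> smooth L (\<phi> i j)"
    and minimizer: "is_arg_min F (\<lambda>_. True) xs"
    and R_pos: "R > 0"
    \<comment> \<open>schedules\<close>
    and amplitude: "0 < \<theta>min" "\<theta>min \<le> \<theta>max" "\<And>t. \<theta> t \<in> {\<theta>min..\<theta>max}"
    and curvature: "\<And>t. L < \<Lambda> t \<and> \<Lambda> t \<le> 2 * L"
    and schedule: "\<And>t. \<Lambda> t * \<theta> t \<le> L / 2"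
    \<comment> \<open>randomness: initial state, minibatches, stochastic gradients computed from them\<close>
    and init: "x 0 \<in> borel_measurable M"
    and batch: "\<And>i t l \<omega>. i < n \<Longrightarrow> l < H i \<Longrightarrow> \<omega> \<in> space M \<Longrightarrow>
        size (\<B> i t l \<omega>) = b i \<and> set_mset (\<B> i t l \<omega>) \<subseteq> {..<m i}"
    and batch_meas: "\<And>i t l. i < n \<Longrightarrow> l < H i \<Longrightarrow> \<B> i t l \<in> measurable M (count_space UNIV)"
    and batch_indep: "\<And>i t l. i < n \<Longrightarrow> l < H i \<Longrightarrow>
        cond_indep_vars M (local_hist M n H (x 0) \<B> i t l) (\<lambda>_. count_space UNIV)
          (\<lambda>(j, k). \<B> j t k) {(j, k). j < n \<and> k < H j}"
    and grad_meas: "\<And>i t l. i < n \<Longrightarrow> l < H i \<Longrightarrow>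
        g i t l \<in> borel_measurable (local_hist M n H (x 0) \<B> i t (Suc l))"
    \<comment> \<open>local steps\<close>
    and local_init: "\<And>i t \<omega>. i < n \<Longrightarrow> \<omega> \<in> space M \<Longrightarrow> y i t 0 \<omega> = x t \<omega>"
    and local_update: "\<And>i t l \<omega>. i < n \<Longrightarrow> l < H i \<Longrightarrow> \<omega> \<in> space M \<Longrightarrow>
        y i t (Suc l) \<omega> = y i t l \<omega> - local_step L (\<theta> t) (H i) *\<^sub>R g i t l \<omega>"
    \<comment> \<open>server step\<close>
    and weights: "\<And>t \<omega>. \<omega> \<in> space M \<Longrightarrow>
        is_arg_min (\<Psi>_hom n L (\<theta> t) (\<Lambda> t) H (\<Delta> t \<omega>)) (\<lambda>u. u \<in> simplex_weights n) (w t \<omega>)"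
    and weights_meas: "\<And>i t. i < n \<Longrightarrow>
        (\<lambda>\<omega>. w t \<omega> i) \<in> borel_measurable (round_hist M n H (x 0) \<B> (Suc t))"
    and server_update: "\<And>t \<omega>. \<omega> \<in> space M \<Longrightarrow>
        x (Suc t) \<omega> = x t \<omega> + aggregate n (\<Delta> t \<omega>) (w t \<omega>)"
    \<comment> \<open>boundedness and homogeneous oracle\<close>
    and bounded: "AE \<omega> in M. \<forall>t. x t \<omega> \<in> cball xs R \<and>
        (\<forall>i<n. \<forall>l\<le>H i. y i t l \<omega> \<in> cball xs R)"
    and oracle_mean: "\<And>i t l. i < n \<Longrightarrow> l < H i \<Longrightarrow>
        has_cond_exp M (local_hist M n H (x 0) \<B> i t l) (g i t l) (\<lambda>\<omega>. grad F (y i t l \<omega>))"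
    and oracle_var: "\<And>i t l. i < n \<Longrightarrow> l < H i \<Longrightarrow>
        AE \<omega> in M. nn_cond_exp M (local_hist M n H (x 0) \<B> i t l)
            (\<lambda>\<omega>. ennreal ((norm (g i t l \<omega> - grad F (y i t l \<omega>)))\<^sup>2)) \<omega>
          \<le> ennreal (v2 i / real (b i))"
    and PL: "\<And>z. z \<in> cball xs R \<Longrightarrow> (norm (grad F z))\<^sup>2 \<ge> 2 * \<mu> * (F z - F xs)"
  shows "(\<forall>t. gap (Suc t) \<le> (1 - \<rho>_hom \<mu> L (\<theta> t) (\<Lambda> t)) * gap t + \<delta> (\<theta> t) (\<Lambda> t)) \<and>
         (\<forall>\<theta>c \<Lambda>c. (\<forall>t. \<theta> t = \<theta>c) \<longrightarrow> (\<forall>t. \<Lambda> t = \<Lambda>c) \<longrightarrow> \<rho>_hom \<mu> L \<theta>c \<Lambda>c > 0 \<longrightarrow>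
           (\<forall>t. gap t \<le> (1 - \<rho>_hom \<mu> L \<theta>c \<Lambda>c) ^ t * gap 0 + \<delta> \<theta>c \<Lambda>c / \<rho>_hom \<mu> L \<theta>c \<Lambda>c))"
proof -
  interpret prob_space M by (rule prob)
  define rh where "rh = round_hist M n H (x 0) \<B>"
  define lh where "lh = local_hist M n H (x 0) \<B>"
  define \<xi> where "\<xi> i t l \<omega> = g i t l \<omega> - grad F (y i t l \<omega>)" for i t l \<omega>
  define V1 Vu where "V1 = V_bar1 n H b v2" and "Vu = V_u n H b v2"
  have H: "H i \<ge> 1" if "i < n" for i using sizes(2)[OF that] by simp
  have F: "smooth L F" unfolding F_def
    using sizes smooth by (intro smooth_obj) auto
  have Fmin: "F xs \<le> F z" for z using minimizer unfolding is_arg_min_def by (meson not_le)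
  have gradF: "grad F \<in> borel_measurable borel"
    by (rule borel_measurable_continuous_onI[OF smooth_continuous_grad[OF F]])
  have Fmeas: "F \<in> borel_measurable borel"
    by (rule borel_measurable_continuous_onI[OF smooth_continuous[OF F]])
  have v2: "0 \<le> v2 i" if "i < n" for i
    unfolding v2_def using sizes(2)[OF that] smooth[OF that] R_pos
    by (intro grad_var_nonneg[where L = L]) auto
  have \<theta>: "0 < \<theta> t" for t using amplitude(1) amplitude(3)[of t] by simp
  have \<theta>_half: "\<theta> t < 1 / 2" for t
  proof -
    have "L * \<theta> t < \<Lambda> t * \<theta> t" using curvature[of t] \<theta>[of t] by simp
    then have "L * \<theta> t < L * (1 / 2)" using schedule[of t] by linarith
    then show ?thesis using L_pos by simp
  qed

  \<comment> \<open>The histories form a filtration inside each round and from round to round.\<close>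
  have sub_lh: "subalgebra M (lh i t l)" if "i < n" "l \<le> H i" for i t l
    unfolding subalgebra_def lh_def
    using sets_local_hist_subset[where n = n and H = H and \<B> = \<B>, OF init batch_meas that] by simp
  have sub_lh_mono: "subalgebra (lh i t l') (lh i t l)" if "l \<le> l'" for i t l l'
    unfolding subalgebra_def lh_def using sets_local_hist_mono[OF that] by simp
  have sub_rh_lh: "subalgebra (lh i t l) (rh t)" for i t l
    unfolding subalgebra_def lh_def rh_def using sets_round_hist_le_local_hist by simp
  have sub_lh_rh: "subalgebra (rh (Suc t)) (lh i t l)" if "i < n" "l \<le> H i" for i t l
    unfolding subalgebra_def lh_def rh_def
    using sets_local_hist_le_round_hist[where n = n and H = H, OF that] by simp
  have sub_rh: "subalgebra M (rh t)" for t
    unfolding subalgebra_def rh_def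
    using sets_round_hist_subset[where n = n and H = H and \<B> = \<B>, OF init batch_meas] by simp
  have sub_rh_Suc: "subalgebra (rh (Suc t)) (rh t)" for t
    unfolding subalgebra_def rh_def using sets_round_hist_mono by simp

  \<comment> \<open>Iterates are measurable with respect to the history that precedes them.\<close>
  have y_meas_if: "y i t l \<in> borel_measurable (lh i t l)"
    if x: "x t \<in> borel_measurable (rh t)" and i: "i < n" and l: "l \<le> H i" for i t l
    using l
  proof (induction l)
    case 0
    have "x t \<in> borel_measurable (lh i t 0)" by (rule measurable_from_subalg[OF sub_rh_lh x])
    then show ?case
      using local_init[OF i] by (subst measurable_cong[where g = "x t"]) (auto simp: lh_def)
  next
    case (Suc l)
    have [measurable]: "y i t l \<in> borel_measurable (lh i t (Suc l))"
      using Suc by (intro measurable_from_subalg[OF sub_lh_mono[of l "Suc l"]]) auto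
    have [measurable]: "g i t l \<in> borel_measurable (lh i t (Suc l))"
      unfolding lh_def using Suc by (intro grad_meas i) simp
    have "(\<lambda>\<omega>. y i t l \<omega> - local_step L (\<theta> t) (H i) *\<^sub>R g i t l \<omega>) \<in> borel_measurable (lh i t (Suc l))"
      by measurable
    then show ?case
      using local_update[OF i, of l] Suc(2) by (subst measurable_cong) (auto simp: lh_def)
  qed
  have x_meas: "x t \<in> borel_measurable (rh t)" for t
  proof (induction t)
    case 0
    show ?case
    proof (rule measurableI)
      fix A :: "'a set" assume "A \<in> sets borel"
      then show "x 0 -` A \<inter> space (rh 0) \<in> sets (rh 0)"
        unfolding rh_def sets_round_hist space_round_hist by (intro sigma_sets.Basic) blast
    qed simp
  next
    case (Suc t)
    have [measurable]: "x t \<in> borel_measurable (rh (Suc t))"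
      by (rule measurable_from_subalg[OF sub_rh_Suc Suc])
    have y: "y i t (H i) \<in> borel_measurable (rh (Suc t))" if "i < n" for i
      by (rule measurable_from_subalg[OF sub_lh_rh[OF that order_refl] y_meas_if[OF Suc that order_refl]])
    have "(\<lambda>\<omega>. x t \<omega> + (\<Sum>i<n. w t \<omega> i *\<^sub>R (y i t (H i) \<omega> - x t \<omega>))) \<in> borel_measurable (rh (Suc t))"
      using y weights_meas[of _ t] unfolding rh_def[symmetric]
      by (intro borel_measurable_add borel_measurable_sum borel_measurable_scaleR borel_measurable_diff) auto
    then show ?case
      using server_update[of _ t] by (subst measurable_cong) (auto simp: rh_def aggregate_def \<Delta>_def)
  qed
  have xM [measurable]: "x t \<in> borel_measurable M" for t
    by (rule measurable_from_subalg[OF sub_rh x_meas])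
  note y_meas = y_meas_if[OF x_meas]
  have gF_y: "(\<lambda>\<omega>. grad F (y i t l \<omega>)) \<in> borel_measurable (lh i t l)" if "i < n" "l \<le> H i" for i t l
    using y_meas[OF that] gradF by (rule measurable_compose)
  have \<xi>_meas: "\<xi> i t l \<in> borel_measurable (lh i t (Suc l))" if "i < n" "l < H i" for i t l
  proof -
    have "(\<lambda>\<omega>. grad F (y i t l \<omega>)) \<in> borel_measurable (lh i t (Suc l))"
      using that by (intro measurable_from_subalg[OF sub_lh_mono[of l "Suc l"] gF_y]) auto
    then show ?thesis using grad_meas[OF that] unfolding \<xi>_def lh_def by simp
  qed
  have \<xi>M: "\<xi> i t l \<in> borel_measurable M" if "i < n" "l < H i" for i t l
    using that by (intro measurable_from_subalg[OF sub_lh \<xi>_meas]) auto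

  \<comment> \<open>Two consecutive local iterates lie in the ball, so the stochastic gradient between them is bounded
    by the diameter over the step size.\<close>
  define Cg where "Cg = norm (grad F xs) + L * R"
  define C\<xi> where "C\<xi> i t = 2 * R / local_step L (\<theta> t) (H i) + Cg" for i t
  have gF_bdd: "norm (grad F z) \<le> Cg" if "z \<in> cball xs R" for z
  proof -
    have "norm (grad F z) \<le> norm (grad F xs) + norm (grad F z - grad F xs)" by norm
    also have "\<dots> \<le> norm (grad F xs) + L * norm (z - xs)"
      using smooth_grad_diff[OF F] by (intro add_left_mono)
    also have "\<dots> \<le> Cg"
      unfolding Cg_def using that L_pos by (simp add: dist_norm norm_minus_commute)
    finally show ?thesis .
  qed
  have \<xi>_bdd: "AE \<omega> in M. norm (\<xi> i t l \<omega>) \<le> C\<xi> i t" if i: "i < n" "l < H i" for i t l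
    using bounded AE_space
  proof eventually_elim
    case (elim \<omega>)
    define s where "s = local_step L (\<theta> t) (H i)"
    have s: "s > 0" unfolding s_def local_step_def using \<theta>[of t] L_pos H[OF i(1)] by simp
    have "norm (y i t l \<omega> - y i t (Suc l) \<omega>) = s * norm (g i t l \<omega>)"
      using local_update[OF i elim(2), of t] s unfolding s_def[symmetric] by simp
    moreover have "y i t l \<omega> \<in> cball xs R" "y i t (Suc l) \<omega> \<in> cball xs R"
      using elim i by auto
    then have "norm (y i t l \<omega> - y i t (Suc l) \<omega>) \<le> 2 * R" "norm (grad F (y i t l \<omega>)) \<le> Cg"
      using norm_triangle_ineq4[of "xs - y i t (Suc l) \<omega>" "xs - y i t l \<omega>"] gF_bdd
      by (auto simp: dist_norm)
    ultimately have "norm (g i t l \<omega>) \<le> 2 * R / s" "norm (grad F (y i t l \<omega>)) \<le> Cg"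
      using s by (simp_all add: field_simps)
    then show ?case
      unfolding \<xi>_def C\<xi>_def s_def[symmetric]
      using norm_triangle_ineq4[of "g i t l \<omega>" "grad F (y i t l \<omega>)"] by linarith
  qed
  have \<xi>_int: "integrable M (\<lambda>\<omega>. \<xi> i t l \<omega> \<bullet> \<xi> j t k \<omega>)"
    if "i < n" "l < H i" "j < n" "k < H j" for i j l k t
  proof (rule integrable_const_bound)
    show "AE \<omega> in M. norm (\<xi> i t l \<omega> \<bullet> \<xi> j t k \<omega>) \<le> C\<xi> i t * C\<xi> j t"
      using \<xi>_bdd[OF that(1,2), of t] \<xi>_bdd[OF that(3,4), of t]
    proof eventually_elim
      case (elim \<omega>)
      have "0 \<le> C\<xi> i t" using elim(1) norm_ge_zero order_trans by blast
      have "norm (\<xi> i t l \<omega> \<bullet> \<xi> j t k \<omega>) \<le> norm (\<xi> i t l \<omega>) * norm (\<xi> j t k \<omega>)"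
        unfolding real_norm_def by (rule Cauchy_Schwarz_ineq2)
      also have "\<dots> \<le> C\<xi> i t * C\<xi> j t" using elim \<open>0 \<le> C\<xi> i t\<close> by (intro mult_mono) auto
      finally show ?case .
    qed
  qed (use \<xi>M[OF that(1,2)] \<xi>M[OF that(3,4)] in measurable)
  have \<xi>_mean: "integrable M (\<lambda>\<omega>. \<xi> i t l \<omega> \<bullet> e)"
      "AE \<omega> in M. real_cond_exp M (lh i t l) (\<lambda>\<omega>. \<xi> i t l \<omega> \<bullet> e) \<omega> = 0"
    if i: "i < n" "l < H i" and e: "e \<in> Basis" for i l t e
  proof -
    have sub: "subalgebra M (lh i t l)" using i by (intro sub_lh) auto
    interpret G: sigma_finite_subalgebra M "lh i t l" by (rule sigma_finite_subalgebraI[OF sub])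
    have gi: "integrable M (\<lambda>\<omega>. g i t l \<omega> \<bullet> e)"
      using oracle_mean[OF i] unfolding has_cond_exp_def by (intro integrable_inner_left) auto
    have gm: "(\<lambda>\<omega>. grad F (y i t l \<omega>) \<bullet> e) \<in> borel_measurable (lh i t l)"
      using gF_y[of i l t] i by simp
    have Fi: "integrable M (\<lambda>\<omega>. grad F (y i t l \<omega>) \<bullet> e)"
    proof (rule integrable_const_bound)
      show "AE \<omega> in M. norm (grad F (y i t l \<omega>) \<bullet> e) \<le> Cg"
        using bounded
      proof eventually_elim
        case (elim \<omega>)
        then have "norm (grad F (y i t l \<omega>)) \<le> Cg" using i by (intro gF_bdd) auto
        then show ?case using Basis_le_norm[OF e, of "grad F (y i t l \<omega>)"] by simp
      qed
    qed (rule measurable_from_subalg[OF sub gm])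
    show "integrable M (\<lambda>\<omega>. \<xi> i t l \<omega> \<bullet> e)"
      unfolding \<xi>_def inner_diff_left by (intro Bochner_Integration.integrable_diff gi Fi)
    have "AE \<omega> in M. \<forall>e\<in>Basis. real_cond_exp M (lh i t l) (\<lambda>\<omega>. g i t l \<omega> \<bullet> e) \<omega> = grad F (y i t l \<omega>) \<bullet> e"
      using oracle_mean[OF i] unfolding has_cond_exp_def lh_def by blast
    with G.real_cond_exp_diff[OF gi Fi] G.real_cond_exp_F_meas[OF Fi gm]
    show "AE \<omega> in M. real_cond_exp M (lh i t l) (\<lambda>\<omega>. \<xi> i t l \<omega> \<bullet> e) \<omega> = 0"
      unfolding \<xi>_def inner_diff_left by eventually_elim (use e in simp)
  qed
  have \<xi>_var: "(\<integral>\<omega>. (norm (\<xi> i t l \<omega>))\<^sup>2 \<partial>M) \<le> v2 i / real (b i)" if i: "i < n" "l < H i" for i l t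
  proof (rule integral_le_of_nn_cond_exp_le)
    show "subalgebra M (lh i t l)" using i by (intro sub_lh) auto
    show "integrable M (\<lambda>\<omega>. (norm (\<xi> i t l \<omega>))\<^sup>2)"
      unfolding power2_norm_eq_inner by (rule \<xi>_int[OF i i])
    show "AE \<omega> in M. nn_cond_exp M (lh i t l) (\<lambda>\<omega>. ennreal ((norm (\<xi> i t l \<omega>))\<^sup>2)) \<omega> \<le> ennreal (v2 i / real (b i))"
      using oracle_var[OF i] unfolding \<xi>_def lh_def .
  qed (use v2 i in auto)

  \<comment> \<open>Orthogonality, first along one node and then between two nodes.\<close>
  have \<xi>_orth_own: "(\<integral>\<omega>. \<xi> i t l \<omega> \<bullet> \<xi> i t k \<omega> \<partial>M) = 0" if i: "i < n" "l < H i" and k: "k < l" for i l k t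
  proof (rule cond_centred_orthogonal)
    show "subalgebra M (lh i t l)" using i by (intro sub_lh) auto
    show "\<xi> i t k \<in> borel_measurable (lh i t l)"
      using i k by (intro measurable_from_subalg[OF sub_lh_mono[of "Suc k" l] \<xi>_meas]) auto
    show "AE \<omega> in M. norm (\<xi> i t k \<omega>) \<le> C\<xi> i t" using i k by (intro \<xi>_bdd) auto
  qed (use \<xi>M[OF i] \<xi>_bdd[OF i] \<xi>_mean(2)[OF i] in auto)
  have \<xi>_orth_nodes: "(\<integral>\<omega>. \<xi> i t l \<omega> \<bullet> \<xi> j t k \<omega> \<partial>M) = 0"
    if i: "i < n" "l < H i" and j: "j < n" "k < H j" and ij: "i \<noteq> j" for i l j k t
  proof (rule cond_centred_orthogonal)
    show "subalgebra M (lh j t (Suc k))" using j by (intro sub_lh) auto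
    fix e :: 'a assume e: "e \<in> Basis"
    show "AE \<omega> in M. real_cond_exp M (lh j t (Suc k)) (\<lambda>\<omega>. \<xi> i t l \<omega> \<bullet> e) \<omega> = 0"
    proof (rule cond_indep_zero_mean[where F = "lh i t 0" and ?G1.0 = "lh i t (Suc l)"
          and ?P1.0 = "range (batch_cylinder M \<B> i t (Suc l))" and ?P2.0 = "range (batch_cylinder M \<B> j t (Suc k))"])
      have lh0: "lh i t 0 = lh j t 0" unfolding lh_def by (rule local_hist_0_eq)
      show "subalgebra M (lh i t 0)" "subalgebra M (lh i t (Suc l))" "subalgebra M (lh j t (Suc k))"
        using i j by (auto intro!: sub_lh)
      show "subalgebra (lh i t (Suc l)) (lh i t 0)" by (rule sub_lh_mono) simp
      show "range (batch_cylinder M \<B> i t (Suc l)) \<subseteq> events"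
        using batch_cylinder_sets[of M \<B> i t "Suc l" _ n H "x 0"] sub_lh[of i "Suc l" t] i
        unfolding lh_def subalgebra_def by fastforce
      show "range (batch_cylinder M \<B> j t (Suc k)) \<subseteq> events"
        using batch_cylinder_sets[of M \<B> j t "Suc k" _ n H "x 0"] sub_lh[of j "Suc k" t] j
        unfolding lh_def subalgebra_def by fastforce
      show "sets (lh i t (Suc l)) = sigma_sets (space M)
          {A \<inter> D |A D. A \<in> sets (lh i t 0) \<and> D \<in> range (batch_cylinder M \<B> i t (Suc l))}"
        unfolding lh_def by (rule sets_local_hist_cylinders)
      show "sets (lh j t (Suc k)) = sigma_sets (space M)
          {A \<inter> D |A D. A \<in> sets (lh i t 0) \<and> D \<in> range (batch_cylinder M \<B> j t (Suc k))}"
        unfolding lh0 unfolding lh_def by (rule sets_local_hist_cylinders)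
      have "cond_indep_vars M (lh i t 0) (\<lambda>_. count_space UNIV) (\<lambda>(j, k). \<B> j t k) {(j, k). j < n \<and> k < H j}"
        unfolding lh_def using i by (intro batch_indep) auto
      then show "AE \<omega> in M. cond_prob M (lh i t 0) (D \<inter> E) \<omega>
          = cond_prob M (lh i t 0) D \<omega> * cond_prob M (lh i t 0) E \<omega>"
        if "D \<in> range (batch_cylinder M \<B> i t (Suc l))" "E \<in> range (batch_cylinder M \<B> j t (Suc k))" for D E
        using batch_cylinders_cond_indep[OF _ i(1) j(1) ij i(2) j(2)] that by blast
      show "integrable M (\<lambda>\<omega>. \<xi> i t l \<omega> \<bullet> e)" by (rule \<xi>_mean(1)[OF i e])
      show "(\<lambda>\<omega>. \<xi> i t l \<omega> \<bullet> e) \<in> borel_measurable (lh i t (Suc l))" using \<xi>_meas[OF i] by simp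
      show "AE \<omega> in M. real_cond_exp M (lh i t 0) (\<lambda>\<omega>. \<xi> i t l \<omega> \<bullet> e) \<omega> = 0"
        using i by (intro real_cond_exp_zero_subalgebra[OF sub_lh sub_lh_mono \<xi>_mean(1) \<xi>_mean(2)] e) auto
    qed (auto intro: Int_stable_batch_cylinders space_in_batch_cylinders)
  qed (use \<xi>M[OF i] \<xi>_bdd[OF i] \<xi>_meas[OF j] \<xi>_bdd[OF j] in auto)
  have \<xi>_orth: "(\<integral>\<omega>. \<xi> i t l \<omega> \<bullet> \<xi> j t k \<omega> \<partial>M) = 0"
    if "i < n" "l < H i" "j < n" "k < H j" "(i, l) \<noteq> (j, k)" for i l j k t
  proof (cases "i = j")
    case True
    then have "k < l \<or> l < k" using that by auto
    then show ?thesis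
      using \<xi>_orth_own[of i l k t] \<xi>_orth_own[of i k l t] that True by (auto simp: inner_commute)
  next
    case False
    then show ?thesis using \<xi>_orth_nodes that by blast
  qed

  \<comment> \<open>\<open>N\<close> and \<open>Z\<close> are the squared sums of increments in the pathwise round estimate, \<open>N\<close> within one node
    and \<open>Z\<close> over all nodes; \<open>D\<close> below is the noise part of the drift.\<close>
  define N where "N i t l \<omega> = (norm (\<Sum>k<l. \<xi> i t k \<omega>))\<^sup>2" for i t l \<omega>
  define Z where "Z t \<omega> = (norm ((1 / real n) *\<^sub>R (\<Sum>i<n. (1 / real (H i)) *\<^sub>R (\<Sum>l<H i. \<xi> i t l \<omega>))))\<^sup>2" for t \<omega>
  have N: "integrable M (N i t l)" "(\<integral>\<omega>. N i t l \<omega> \<partial>M) \<le> real l * (v2 i / real (b i))"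
    if i: "i < n" "l < H i" for i t l
  proof -
    have "integrable M (\<lambda>\<omega>. (norm (\<Sum>k<l. 1 *\<^sub>R \<xi> i t k \<omega>))\<^sup>2)"
      "(\<integral>\<omega>. (norm (\<Sum>k<l. 1 *\<^sub>R \<xi> i t k \<omega>))\<^sup>2 \<partial>M) = (\<Sum>k<l. 1\<^sup>2 * (\<integral>\<omega>. (norm (\<xi> i t k \<omega>))\<^sup>2 \<partial>M))"
      using i by (intro integral_norm_sum_orthogonal[where c = "\<lambda>_. 1"] \<xi>_int \<xi>_orth; simp)+
    moreover have "(\<Sum>k<l. (\<integral>\<omega>. (norm (\<xi> i t k \<omega>))\<^sup>2 \<partial>M)) \<le> (\<Sum>k<l. v2 i / real (b i))"
      using i by (intro sum_mono \<xi>_var) auto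
    ultimately show "integrable M (N i t l)" "(\<integral>\<omega>. N i t l \<omega> \<partial>M) \<le> real l * (v2 i / real (b i))"
      unfolding N_def by simp_all
  qed
  have Z: "integrable M (Z t)" "(\<integral>\<omega>. Z t \<omega> \<partial>M) \<le> Vu" for t
  proof -
    define K where "K = Sigma {..<n} (\<lambda>i. {..<H i})"
    define c where "c = (\<lambda>(i::nat, l::nat). 1 / (real n * real (H i)))"
    define X where "X = (\<lambda>(i, l). \<xi> i t l)"
    have "(\<Sum>p\<in>K. c p *\<^sub>R X p \<omega>)
        = (1 / real n) *\<^sub>R (\<Sum>i<n. (1 / real (H i)) *\<^sub>R (\<Sum>l<H i. \<xi> i t l \<omega>))" for \<omega>
      using sum.Sigma[of "{..<n}" "\<lambda>i. {..<H i}" "\<lambda>i l. c (i, l) *\<^sub>R X (i, l) \<omega>"]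
      unfolding K_def c_def X_def by (simp add: scaleR_sum_right split_def)
    then have Ze: "Z t = (\<lambda>\<omega>. (norm (\<Sum>p\<in>K. c p *\<^sub>R X p \<omega>))\<^sup>2)"
      unfolding Z_def by simp
    have "finite K" unfolding K_def by simp
    note orth = integral_norm_sum_orthogonal[OF this, of M X c]
    have Xint: "integrable M (\<lambda>\<omega>. X p \<omega> \<bullet> X q \<omega>)" if "p \<in> K" "q \<in> K" for p q
      using that unfolding K_def X_def by (auto intro!: \<xi>_int)
    have Xorth: "(\<integral>\<omega>. X p \<omega> \<bullet> X q \<omega> \<partial>M) = 0" if "p \<in> K" "q \<in> K" "p \<noteq> q" for p q
      using that unfolding K_def X_def by (auto intro!: \<xi>_orth)
    show "integrable M (Z t)" unfolding Ze by (intro orth(1) Xint Xorth)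
    have "(\<integral>\<omega>. Z t \<omega> \<partial>M) = (\<Sum>p\<in>K. (c p)\<^sup>2 * (\<integral>\<omega>. (norm (X p \<omega>))\<^sup>2 \<partial>M))"
      unfolding Ze by (intro orth(2) Xint Xorth)
    also have "\<dots> \<le> (\<Sum>p\<in>K. (c p)\<^sup>2 * (v2 (fst p) / real (b (fst p))))"
      unfolding K_def X_def by (intro sum_mono mult_left_mono) (auto intro!: \<xi>_var)
    also have "\<dots> = (\<Sum>i<n. \<Sum>l<H i. (1 / (real n * real (H i)))\<^sup>2 * (v2 i / real (b i)))"
      using sum.Sigma[of "{..<n}" "\<lambda>i. {..<H i}" "\<lambda>i l. (c (i, l))\<^sup>2 * (v2 i / real (b i))"]
      unfolding K_def c_def by (simp add: split_def)
    also have "\<dots> = (\<Sum>i<n. (1 / (real n)\<^sup>2) * (v2 i / (real (H i) * real (b i))))"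
    proof (intro sum.cong refl)
      fix i assume "i \<in> {..<n}"
      then have "real (H i) > 0" using H by fastforce
      then show "(\<Sum>l<H i. (1 / (real n * real (H i)))\<^sup>2 * (v2 i / real (b i)))
          = (1 / (real n)\<^sup>2) * (v2 i / (real (H i) * real (b i)))"
        by (simp add: power2_eq_square)
    qed
    also have "\<dots> = Vu" unfolding Vu_def V_u_def by (rule sum_distrib_left[symmetric])
    finally show "(\<integral>\<omega>. Z t \<omega> \<partial>M) \<le> Vu" .
  qed
  define D where "D t \<omega> = (1 / real n) * (\<Sum>i<n. 4 * (\<theta> t)\<^sup>2 / (real (H i))^3 * (\<Sum>l<H i. N i t l \<omega>))" for t \<omega>
  have D: "integrable M (D t)" "(\<integral>\<omega>. D t \<omega> \<partial>M) \<le> 2 * (\<theta> t)\<^sup>2 * V1" for t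
  proof -
    show "integrable M (D t)" unfolding D_def
      by (intro integrable_mult_right Bochner_Integration.integrable_sum N) auto
    have "(\<integral>\<omega>. D t \<omega> \<partial>M)
        = (1 / real n) * (\<Sum>i<n. 4 * (\<theta> t)\<^sup>2 / (real (H i))^3 * (\<Sum>l<H i. (\<integral>\<omega>. N i t l \<omega> \<partial>M)))"
    proof -
      have node: "(\<integral>\<omega>. 4 * (\<theta> t)\<^sup>2 / (real (H i))^3 * (\<Sum>l<H i. N i t l \<omega>) \<partial>M)
          = 4 * (\<theta> t)\<^sup>2 / (real (H i))^3 * (\<Sum>l<H i. (\<integral>\<omega>. N i t l \<omega> \<partial>M))" if "i < n" for i
        using N(1)[OF that]
        by (subst integral_mult_right_zero, subst Bochner_Integration.integral_sum) auto
      have "(\<integral>\<omega>. (\<Sum>i<n. 4 * (\<theta> t)\<^sup>2 / (real (H i))^3 * (\<Sum>l<H i. N i t l \<omega>)) \<partial>M)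
          = (\<Sum>i<n. (\<integral>\<omega>. 4 * (\<theta> t)\<^sup>2 / (real (H i))^3 * (\<Sum>l<H i. N i t l \<omega>) \<partial>M))"
        by (intro Bochner_Integration.integral_sum integrable_mult_right
            Bochner_Integration.integrable_sum N) auto
      also have "\<dots> = (\<Sum>i<n. 4 * (\<theta> t)\<^sup>2 / (real (H i))^3 * (\<Sum>l<H i. (\<integral>\<omega>. N i t l \<omega> \<partial>M)))"
        by (intro sum.cong refl node) simp
      finally show ?thesis unfolding D_def by (simp only: integral_mult_right_zero)
    qed
    also have "\<dots> \<le> (1 / real n) * (\<Sum>i<n. 2 * (\<theta> t)\<^sup>2 * (v2 i / (real (H i) * real (b i))))"
    proof (intro mult_left_mono sum_mono)
      fix i assume "i \<in> {..<n}"
      then have i: "i < n" by simp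
      have h: "real (H i) > 0" using H[OF i] by simp
      have "(\<Sum>l<H i. (\<integral>\<omega>. N i t l \<omega> \<partial>M)) \<le> (\<Sum>l<H i. real l * (v2 i / real (b i)))"
        using i by (intro sum_mono N) auto
      also have "\<dots> = (\<Sum>l<H i. real l) * (v2 i / real (b i))" by (rule sum_distrib_right[symmetric])
      also have "\<dots> \<le> (real (H i))\<^sup>2 / 2 * (v2 i / real (b i))"
        using v2[OF i] by (intro mult_right_mono sum_of_nat_le) auto
      finally have "4 * (\<theta> t)\<^sup>2 / (real (H i))^3 * (\<Sum>l<H i. (\<integral>\<omega>. N i t l \<omega> \<partial>M))
          \<le> 4 * (\<theta> t)\<^sup>2 / (real (H i))^3 * ((real (H i))\<^sup>2 / 2 * (v2 i / real (b i)))"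
        by (intro mult_left_mono) auto
      also have "\<dots> = 2 * (\<theta> t)\<^sup>2 * (v2 i / (real (H i) * real (b i)))"
        using h by (simp add: field_simps power2_eq_square power3_eq_cube)
      finally show "4 * (\<theta> t)\<^sup>2 / (real (H i))^3 * (\<Sum>l<H i. (\<integral>\<omega>. N i t l \<omega> \<partial>M))
          \<le> 2 * (\<theta> t)\<^sup>2 * (v2 i / (real (H i) * real (b i)))" .
    qed simp
    also have "\<dots> = 2 * (\<theta> t)\<^sup>2 * V1"
      unfolding V1_def V_bar1_def by (simp add: sum_distrib_left mult_ac)
    finally show "(\<integral>\<omega>. D t \<omega> \<partial>M) \<le> 2 * (\<theta> t)\<^sup>2 * V1" .
  qed

  define f where "f t \<omega> = F (x t \<omega>) - F xs" for t \<omega>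
  have f0: "0 \<le> f t \<omega>" for t \<omega> unfolding f_def using Fmin by simp
  have f_int: "integrable M (f t)" for t
  proof -
    have "continuous_on (cball xs R) F" using smooth_continuous[OF F] by (rule continuous_on_subset) simp
    then have "bounded (F ` cball xs R)"
      by (intro compact_imp_bounded compact_continuous_image compact_cball)
    then obtain C where C: "\<And>z. z \<in> cball xs R \<Longrightarrow> norm (F z) \<le> C" unfolding bounded_iff by blast
    have "integrable M (\<lambda>\<omega>. F (x t \<omega>))"
    proof (rule integrable_const_bound)
      show "AE \<omega> in M. norm (F (x t \<omega>)) \<le> C" using bounded by eventually_elim (intro C, blast)
    qed (use measurable_compose[OF xM Fmeas] in simp)
    then show ?thesis unfolding f_def by simp
  qed
  have gap_f: "gap t = (\<integral>\<omega>. f t \<omega> \<partial>M)" for t unfolding gap_def f_def ..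
  have gap0: "0 \<le> gap t" for t unfolding gap_f using f0 by (intro integral_nonneg_AE) auto
  have V: "0 \<le> V1" "0 \<le> Vu"
    unfolding V1_def Vu_def V_bar1_def V_u_def using v2 by (auto intro!: mult_nonneg_nonneg sum_nonneg divide_nonneg_nonneg)
  \<comment> \<open>Both constants of the recursion carry the factor \<open>\<kappa>\<close> in front of the squared error.\<close>
  define \<kappa> where "\<kappa> t = \<theta> t / L + 1 / (\<Lambda> t - L)" for t
  have \<kappa>: "0 \<le> \<kappa> t" for t unfolding \<kappa>_def using \<theta>[of t] L_pos curvature[of t] by simp
  have \<beta>_\<kappa>: "\<beta>_hom L (\<theta> t) (\<Lambda> t) = 16 * L * (\<theta> t)\<^sup>2 * \<kappa> t" for t
    unfolding \<beta>_hom_def \<kappa>_def using L_pos by (simp add: field_simps power2_eq_square power3_eq_cube)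
  have \<delta>_\<kappa>: "\<delta> (\<theta> t) (\<Lambda> t) = \<kappa> t * (4 * (\<theta> t)\<^sup>2 * V1 + Vu)" for t
    unfolding \<delta>_def \<delta>_hom_def \<kappa>_def V1_def[symmetric] Vu_def[symmetric]
    by (simp add: algebra_simps power2_eq_square power3_eq_cube)

  have round: "AE \<omega> in M. f (Suc t) \<omega> \<le> (1 - \<mu> * \<theta> t / (2 * L) + \<kappa> t * (8 * L * (\<theta> t)\<^sup>2)) * f t \<omega>
      + \<kappa> t * (Z t \<omega> + D t \<omega>)" for t
    using bounded AE_space
  proof eventually_elim
    case (elim \<omega>)
    define G where "G = (norm (grad F (x t \<omega>)))\<^sup>2"
    have "F (x (Suc t) \<omega>) \<le> F (x t \<omega>) - \<theta> t / (4 * L) * G + \<kappa> t * (Z t \<omega> + D t \<omega> + 4 * (\<theta> t)\<^sup>2 * G)"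
      using round_decrease[where H = H and y = "\<lambda>i l. y i t l \<omega>" and g = "\<lambda>i l. g i t l \<omega>",
          OF F sizes(1) H L_pos _ \<theta>[of t] schedule[of t]
            local_init[OF _ elim(2)] local_update[OF _ _ elim(2)] weights[OF elim(2), of t, unfolded \<Delta>_def]]
        curvature[of t] server_update[OF elim(2), of t]
      unfolding \<Delta>_def \<kappa>_def Z_def D_def N_def \<xi>_def G_def by simp
    moreover have "\<theta> t / (4 * L) * G \<ge> \<theta> t / (4 * L) * (2 * \<mu> * f t \<omega>)"
      unfolding G_def f_def using PL elim(1) \<theta>[of t] L_pos by (intro mult_left_mono) auto
    moreover have "\<kappa> t * (4 * (\<theta> t)\<^sup>2 * G) \<le> \<kappa> t * (4 * (\<theta> t)\<^sup>2 * (2 * L * f t \<omega>))"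
      unfolding G_def f_def using smooth_grad_le_gap[OF F L_pos Fmin] \<kappa> by (intro mult_left_mono) auto
    ultimately show ?case unfolding f_def by (simp add: algebra_simps diff_divide_distrib)
  qed
  have step: "gap (Suc t) \<le> (1 - \<rho>_hom \<mu> L (\<theta> t) (\<Lambda> t)) * gap t + \<delta> (\<theta> t) (\<Lambda> t)" for t
  proof -
    let ?a = "1 - \<mu> * \<theta> t / (2 * L) + \<kappa> t * (8 * L * (\<theta> t)\<^sup>2)"
    have "gap (Suc t) \<le> (\<integral>\<omega>. ?a * f t \<omega> + \<kappa> t * (Z t \<omega> + D t \<omega>) \<partial>M)"
      unfolding gap_f
      by (intro integral_mono_AE round f_int Bochner_Integration.integrable_add integrable_mult_right Z D)
    also have "\<dots> = ?a * gap t + \<kappa> t * ((\<integral>\<omega>. Z t \<omega> \<partial>M) + (\<integral>\<omega>. D t \<omega> \<partial>M))"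
      unfolding gap_f using f_int[of t] Z(1)[of t] D(1)[of t] by simp
    also have "\<dots> \<le> ?a * gap t + \<kappa> t * (Vu + 2 * (\<theta> t)\<^sup>2 * V1)"
      using Z(2)[of t] D(2)[of t] \<kappa> by (intro add_left_mono mult_left_mono add_mono) auto
    also have "\<dots> \<le> (1 - \<rho>_hom \<mu> L (\<theta> t) (\<Lambda> t)) * gap t + \<delta> (\<theta> t) (\<Lambda> t)"
    proof (intro add_mono mult_right_mono gap0)
      have "0 \<le> \<kappa> t * (8 * L * (\<theta> t)\<^sup>2)" using \<kappa> L_pos by simp
      then show "?a \<le> 1 - \<rho>_hom \<mu> L (\<theta> t) (\<Lambda> t)"
        unfolding \<rho>_hom_def \<beta>_\<kappa> by (simp add: algebra_simps)
      have "0 \<le> V1 * (\<theta> t)\<^sup>2" using V by simp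
      then show "\<kappa> t * (Vu + 2 * (\<theta> t)\<^sup>2 * V1) \<le> \<delta> (\<theta> t) (\<Lambda> t)"
        unfolding \<delta>_\<kappa> using \<kappa> by (intro mult_left_mono) auto
    qed
    finally show ?thesis .
  qed

  have const: "gap t \<le> (1 - \<rho>_hom \<mu> L \<theta>c \<Lambda>c) ^ t * gap 0 + \<delta> \<theta>c \<Lambda>c / \<rho>_hom \<mu> L \<theta>c \<Lambda>c"
    if c: "\<forall>t. \<theta> t = \<theta>c" "\<forall>t. \<Lambda> t = \<Lambda>c" and pos: "\<rho>_hom \<mu> L \<theta>c \<Lambda>c > 0" for \<theta>c \<Lambda>c t
  proof -
    have \<delta>0: "0 \<le> \<delta> \<theta>c \<Lambda>c" using \<delta>_\<kappa>[of 0] c \<kappa>[of 0] V by simp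
    show ?thesis
    proof (cases "\<exists>z\<in>cball xs R. F z > F xs")
      case True
      then obtain z where z: "z \<in> cball xs R" "F z - F xs > 0" by auto
      \<comment> \<open>The lower and the upper bound on the gradient at \<open>z\<close> force \<open>\<mu> \<le> L\<close>, hence \<open>\<rho>_hom \<le> 1\<close>, which
        the unrolling needs to preserve inequalities.\<close>
      have "2 * \<mu> * (F z - F xs) \<le> 2 * L * (F z - F xs)"
        using PL[OF z(1)] smooth_grad_le_gap[OF F L_pos Fmin, of z] by linarith
      then have "\<mu> \<le> L" using z(2) by simp
      then have "\<mu> * \<theta>c \<le> L * \<theta>c" using \<theta>[of 0] c by (intro mult_right_mono) auto
      then have "\<mu> * \<theta>c / (2 * L) \<le> \<theta>c / 2" using L_pos by (simp add: field_simps)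
      moreover have "0 \<le> \<beta>_hom L \<theta>c \<Lambda>c" using \<beta>_\<kappa>[of 0] c \<kappa>[of 0] L_pos by simp
      ultimately have "\<rho>_hom \<mu> L \<theta>c \<Lambda>c \<le> 1" unfolding \<rho>_hom_def using \<theta>_half[of 0] c by simp
      then show ?thesis using step c pos \<delta>0 by (intro affine_recursion_bound) auto
    next
      case False
      have "gap s = 0" for s
      proof -
        have "AE \<omega> in M. f s \<omega> = 0"
          using bounded
        proof eventually_elim
          case (elim \<omega>)
          then have "\<not> F (x s \<omega>) > F xs" using False by blast
          then show ?case using f0[of s \<omega>] unfolding f_def by linarith
        qed
        then show ?thesis unfolding gap_f by (rule integral_eq_zero_AE)
      qed
      then show ?thesis using \<delta>0 pos by simp
    qed
  qed
  show ?thesis using step const by blast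
qed

end
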